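(* Let $n\ge 1$, let $\mathfrak g=\mathfrak p(n)$ be the periplectic Lie superalgebra over $\mathbb C$ with the choice of positive odd roots $\Delta^+_{\bar 1}=\Delta(\mathfrak g_{1})=\{\varepsilon_i+\varepsilon_j:1\le i\le j\le n\}$ and positive even roots $\Delta^+_{\bar 0}=\{\varepsilon_i-\varepsilon_j:1\le i<j\le n\}$. Let $\rho=-\sum_{i=1}^n i\,\varepsilon_i$ and $$R=\frac{\prod_{1\le i<j\le n}\left(1-e^{-(\varepsilon_i-\varepsilon_j)}\right)}{\prod_{1\le i\le j\le n}\left(1-e^{-(\varepsilon_i+\varepsilon_j)}\right)}.$$ Let $\beta_1=2\varepsilon_n,\ \beta_2=2\varepsilon_{n-1},\ \ldots,\ \beta_n=2\varepsilon_1$. Then $$e^{\rho}R=\sum_{w\in W}(\operatorname{sgn} w)\, w\left(\frac{e^{\rho}}{(1-e^{-\beta_1})(1-e^{-\beta_1-\beta_2})\cdots(1-e^{-\beta_1-\cdots-\beta_n})}\right).$$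
   Context: The periplectic Lie superalgebra $\mathfrak p(n)$ is the Lie superalgebra of all endomorphisms $X$ of an $(n|n)$-dimensional complex superspace $V$ preserving a non-degenerate odd symmetric bilinear form $\beta$ on $V$ (that is, $\beta(Xv,w)+(-1)^{\bar X\bar v}\beta(v,Xw)=0$); in a suitable basis its elements are the matrices $\begin{pmatrix}A&B\\ C&-A^t\end{pmatrix}$ with $A,B,C$ complex $n\times n$ matrices, $B^t=B$, $C^t=-C$. The Cartan subalgebra $\mathfrak h$ is the set of diagonal matrices in it, and $\varepsilon_1,\ldots,\varepsilon_n$ is the standard basis of $\mathfrak h^*$. The root set is $\Delta=\Delta(\mathfrak g_{-1})\cup\Delta(\mathfrak g_0)\cup\Delta(\mathfrak g_1)$, with even roots $\Delta(\mathfrak g_0)=\{\varepsilon_i-\varepsilon_j: i\neq j\}$ and odd roots $\Delta(\mathfrak g_1)=\{\varepsilon_i+\varepsilon_j:1\le i\le j\le n\}$, $\Delta(\mathfrak g_{-1})=\{-(\varepsilon_i+\varepsilon_j):1\le i<j\le n\}$. For a choice of positive roots, the Weyl vector is by definition $\rho_{\bar 0}-\rho_{\bar 1}$, where $\rho_{\bar 0}$ and $\rho_{\bar 1}$ are the half-sums of the positive even and positive odd roots. In this setting $\rho_{\bar 1}$ and $\rho_{\bar 0}-\rho_{\bar 1}$ may be replaced by $W$-invariant shifts; the element used in the claim is exactly $\rho=-\sum_{i=1}^n i\,\varepsilon_i$. The denominator is $R=\prod_{\alpha\in\Delta^+_{\bar 0}}(1-e^{-\alpha})\big/\prod_{\alpha\in\Delta^+_{\bar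 1}}(1-e^{-\alpha})$. The identity is in the rational function field generated by the formal exponentials $e^\lambda$, $\lambda\in\mathfrak h^*$, with $e^\lambda e^\mu=e^{\lambda+\mu}$, $e^0=1$. The Weyl group is $W=S_n$, acting on $\mathfrak h^*$ by $w(\varepsilon_i)=\varepsilon_{w(i)}$ and by field automorphisms $w(e^\lambda)=e^{w\lambda}$; $\operatorname{sgn} w$ is the sign of the permutation $w$. Empty products are $1$. The $k$-th factor of the displayed denominator is $1-e^{-(\beta_1+\cdots+\beta_k)}$, $1\le k\le n$. *)

theory Defs
  imports
    "HOL-Library.Poly_Mapping"
    "HOL-Computational_Algebra.Fraction_Field"
    "HOL-Combinatorics.Permutations"
    "Jordan_Normal_Form.Matrix"
begin

section \<open>Weights\<close>

text \<open>A weight is written in the coordinates dual to the basis \<open>\<epsilon>\<^sub>1, \<epsilon>\<^sub>2, \<dots>\<close>. The single type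
  \<open>weight\<close> serves all \<open>n\<close> at once: the dual Cartan subalgebra of \<open>\<pp>(n)\<close> is the subgroup
  \<open>cartan_dual n\<close> below.\<close>

typedef weight = "{f :: nat \<Rightarrow> complex. finite {i. f i \<noteq> 0}}"
  morphisms coord Abs_weight
  by (rule exI[of _ "\<lambda>_. 0"]) simp

setup_lifting type_definition_weight

lemma weight_eqI: "(\<And>i. coord \<xi> i = coord \<eta> i) \<Longrightarrow> \<xi> = \<eta>"
  by (metis coord_inject ext)

lemma finite_coord [simp]: "finite {i. coord \<xi> i \<noteq> 0}"
  using coord[of \<xi>] by simp

instantiation weight :: ab_group_add
begin

lift_definition zero_weight :: weight is "\<lambda>_. 0" by simp

lift_definition plus_weight :: "weight \<Rightarrow> weight \<Rightarrow> weight" is "\<lambda>f g i. f i + g i"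
proof -
  fix f g :: "nat \<Rightarrow> complex"
  assume "finite {i. f i \<noteq> 0}" "finite {i. g i \<noteq> 0}"
  then show "finite {i. f i + g i \<noteq> 0}"
    by (rule finite_subset[rotated, OF finite_UnI]) auto
qed

lift_definition uminus_weight :: "weight \<Rightarrow> weight" is "\<lambda>f i. - f i" by simp

lift_definition minus_weight :: "weight \<Rightarrow> weight \<Rightarrow> weight" is "\<lambda>f g i. f i - g i"
proof -
  fix f g :: "nat \<Rightarrow> complex"
  assume "finite {i. f i \<noteq> 0}" "finite {i. g i \<noteq> 0}"
  then show "finite {i. f i - g i \<noteq> 0}"
    by (rule finite_subset[rotated, OF finite_UnI]) auto
qed

instance
  by standard (transfer; simp add: algebra_simps)+

end

lift_definition scale_weight :: "complex \<Rightarrow> weight \<Rightarrow> weight" (infixr \<open>*\<^sub>w\<close> 75)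
  is "\<lambda>c f i. c * f i"
  by (rule finite_subset[rotated]) auto

lift_definition eps :: "nat \<Rightarrow> weight" is "\<lambda>i j. if j = i then 1 else 0" by simp

lemma coord_simps [simp]:
  "coord 0 i = 0" "coord (\<xi> + \<eta>) i = coord \<xi> i + coord \<eta> i"
  "coord (- \<xi>) i = - coord \<xi> i" "coord (\<xi> - \<eta>) i = coord \<xi> i - coord \<eta> i"
  "coord (c *\<^sub>w \<xi>) i = c * coord \<xi> i" "coord (eps k) i = (if i = k then 1 else 0)"
  by (transfer; simp)+

lemma coord_sum: "coord (sum f A) i = (\<Sum>a\<in>A. coord (f a) i)"
  by (induction A rule: infinite_finite_induct) auto

definition cartan_dual :: "nat \<Rightarrow> weight set" where
  "cartan_dual n = {\<xi>. \<forall>i. i \<notin> {1..n} \<longrightarrow> coord \<xi> i = 0}"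

text \<open>The lexicographic order on weights has no mathematical significance here. The library derives
  the absence of zero divisors in the group algebra \<open>weight \<Rightarrow>\<^sub>0 complex\<close>, which is needed to form its
  field of fractions, from a translation invariant linear order on the exponents.\<close>

definition complex_lex_less :: "complex \<Rightarrow> complex \<Rightarrow> bool" where
  "complex_lex_less a b \<longleftrightarrow> Re a < Re b \<or> Re a = Re b \<and> Im a < Im b"

instantiation weight :: linordered_ab_group_add
begin

definition less_weight :: "weight \<Rightarrow> weight \<Rightarrow> bool" where
  "less_weight \<xi> \<eta> \<longleftrightarrow>
     (\<exists>i. complex_lex_less (coord \<xi> i) (coord \<eta> i) \<and> (\<forall>j<i. coord \<xi> j = coord \<eta> j))"

definition less_eq_weight :: "weight \<Rightarrow> weight \<Rightarrow> bool" where
  "less_eq_weight \<xi> \<eta> \<longleftrightarrow> \<xi> = \<eta> \<or> \<xi> < \<eta>"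

instance
proof
  have irrefl: "\<not> \<xi> < \<xi>" for \<xi> :: weight
    by (auto simp: less_weight_def complex_lex_less_def)
  have trans: "\<xi> < \<zeta>" if lm: "\<xi> < \<eta>" and mn: "\<eta> < \<zeta>" for \<xi> \<eta> \<zeta> :: weight
  proof -
    obtain i where i: "complex_lex_less (coord \<xi> i) (coord \<eta> i)" "\<forall>j<i. coord \<xi> j = coord \<eta> j"
      using lm by (auto simp: less_weight_def)
    obtain k where k: "complex_lex_less (coord \<eta> k) (coord \<zeta> k)" "\<forall>j<k. coord \<eta> j = coord \<zeta> j"
      using mn by (auto simp: less_weight_def)
    have "complex_lex_less (coord \<xi> (min i k)) (coord \<zeta> (min i k))"
      using i k linorder_less_linear[of i k] by (auto simp: complex_lex_less_def min_def)
    moreover have "\<forall>j<min i k. coord \<xi> j = coord \<zeta> j"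
      using i k by auto
    ultimately show ?thesis
      unfolding less_weight_def by blast
  qed
  fix \<xi> \<eta> \<zeta> :: weight
  show "\<xi> < \<eta> \<longleftrightarrow> \<xi> \<le> \<eta> \<and> \<not> \<eta> \<le> \<xi>"
    using irrefl trans by (auto simp: less_eq_weight_def)
  show "\<xi> \<le> \<xi>"
    by (simp add: less_eq_weight_def)
  show "\<xi> \<le> \<eta> \<Longrightarrow> \<eta> \<le> \<zeta> \<Longrightarrow> \<xi> \<le> \<zeta>"
    using trans by (auto simp: less_eq_weight_def)
  show "\<xi> \<le> \<eta> \<Longrightarrow> \<eta> \<le> \<xi> \<Longrightarrow> \<xi> = \<eta>"
    using irrefl trans by (auto simp: less_eq_weight_def)
  show "\<xi> \<le> \<eta> \<or> \<eta> \<le> \<xi>"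
  proof (cases "\<xi> = \<eta>")
    case False
    define i where "i = (LEAST i. coord \<xi> i \<noteq> coord \<eta> i)"
    have "\<exists>i. coord \<xi> i \<noteq> coord \<eta> i"
      using False weight_eqI by blast
    then have ne: "coord \<xi> i \<noteq> coord \<eta> i"
      unfolding i_def by (rule LeastI_ex)
    have eq: "\<forall>j<i. coord \<xi> j = coord \<eta> j"
      unfolding i_def using not_less_Least by blast
    have "complex_lex_less (coord \<xi> i) (coord \<eta> i) \<or> complex_lex_less (coord \<eta> i) (coord \<xi> i)"
      using ne by (auto simp: complex_lex_less_def complex_eq_iff)
    then show ?thesis
      using eq unfolding less_eq_weight_def less_weight_def by metis
  qed (simp add: less_eq_weight_def)
  show "\<xi> \<le> \<eta> \<Longrightarrow> \<zeta> + \<xi> \<le> \<zeta> + \<eta>"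
    by (auto simp: less_eq_weight_def less_weight_def complex_lex_less_def)
qed

end


section \<open>The periplectic Lie superalgebra and its roots\<close>

text \<open>The sets \<open>periplectic_m1\<close>, \<open>periplectic_0\<close>, \<open>periplectic_1\<close> are the components of the \<open>\<int>\<close>-grading
  \<open>\<gg> = \<gg>\<^sub>-\<^sub>1 \<oplus> \<gg>\<^sub>0 \<oplus> \<gg>\<^sub>1\<close>, with even part \<open>\<gg>\<^sub>0\<close>.
  Matrix indices start at \<open>0\<close>, so \<open>\<epsilon>\<^sub>i\<close> reads off the diagonal entry with index \<open>i - 1\<close>.\<close>

definition periplectic :: "nat \<Rightarrow> complex mat set" where
  "periplectic n = {four_block_mat A B C (- transpose_mat A) | A B C.
     A \<in> carrier_mat n n \<and> B \<in> carrier_mat n n \<and> C \<in> carrier_mat n n \<and>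
     transpose_mat B = B \<and> transpose_mat C = - C}"

definition periplectic_0 :: "nat \<Rightarrow> complex mat set" where
  "periplectic_0 n = {X \<in> periplectic n. \<exists>A D. A \<in> carrier_mat n n \<and> D \<in> carrier_mat n n \<and>
     X = four_block_mat A (0\<^sub>m n n) (0\<^sub>m n n) D}"

definition periplectic_1 :: "nat \<Rightarrow> complex mat set" where
  "periplectic_1 n = {X \<in> periplectic n. \<exists>B \<in> carrier_mat n n.
     X = four_block_mat (0\<^sub>m n n) B (0\<^sub>m n n) (0\<^sub>m n n)}"

definition periplectic_m1 :: "nat \<Rightarrow> complex mat set" where
  "periplectic_m1 n = {X \<in> periplectic n. \<exists>C \<in> carrier_mat n n.
     X = four_block_mat (0\<^sub>m n n) (0\<^sub>m n n) C (0\<^sub>m n n)}"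

definition cartan :: "nat \<Rightarrow> complex mat set" where
  "cartan n = {H \<in> periplectic n. diagonal_mat H}"

definition weight_eval :: "nat \<Rightarrow> weight \<Rightarrow> complex mat \<Rightarrow> complex" where
  "weight_eval n \<alpha> H = (\<Sum>i = 1..n. coord \<alpha> i * H $$ (i - 1, i - 1))"

text \<open>Elements of the Cartan subalgebra are even, so their superbracket with any \<open>X\<close> is the
  ordinary commutator.\<close>

definition root_space :: "nat \<Rightarrow> complex mat set \<Rightarrow> weight \<Rightarrow> complex mat set" where
  "root_space n S \<alpha> = {X \<in> S. \<forall>H \<in> cartan n. H * X - X * H = weight_eval n \<alpha> H \<cdot>\<^sub>m X}"

definition roots_of :: "nat \<Rightarrow> complex mat set \<Rightarrow> weight set" where
  "roots_of n S = {\<alpha> \<in> cartan_dual n. \<alpha> \<noteq> 0 \<and> (\<exists>X \<in> root_space n S \<alpha>. X \<noteq> 0\<^sub>m (2 * n) (2 * n))}"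

definition pos_even_roots :: "nat \<Rightarrow> weight set" where
  "pos_even_roots n = {eps i - eps j | i j. 1 \<le> i \<and> i < j \<and> j \<le> n}"

definition pos_odd_roots :: "nat \<Rightarrow> weight set" where
  "pos_odd_roots n = roots_of n (periplectic_1 n)"


section \<open>The field generated by formal exponentials\<close>

text \<open>The field of fractions of the group algebra of weights over \<open>\<complex>\<close>.\<close>

type_synonym exp_field = "(weight \<Rightarrow>\<^sub>0 complex) fract"

definition fexp :: "weight \<Rightarrow> exp_field" where
  "fexp \<xi> = Fraction_Field.Fract (Poly_Mapping.single \<xi> 1) 1"

definition weyl_weight :: "(nat \<Rightarrow> nat) \<Rightarrow> weight \<Rightarrow> weight" where
  "weyl_weight w \<xi> = (\<Sum>i | coord \<xi> i \<noteq> 0. coord \<xi> i *\<^sub>w eps (w i))"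

definition weyl_alg :: "(nat \<Rightarrow> nat) \<Rightarrow> (weight \<Rightarrow>\<^sub>0 complex) \<Rightarrow> (weight \<Rightarrow>\<^sub>0 complex)" where
  "weyl_alg w f =
     (\<Sum>\<eta> \<in> Poly_Mapping.keys f. Poly_Mapping.single (weyl_weight w \<eta>) (Poly_Mapping.lookup f \<eta>))"

lemma weyl_weight_superset:
  assumes "finite A" "{i. coord \<xi> i \<noteq> 0} \<subseteq> A"
  shows "weyl_weight w \<xi> = (\<Sum>i\<in>A. coord \<xi> i *\<^sub>w eps (w i))"
  unfolding weyl_weight_def
  by (rule sum.mono_neutral_left[OF assms]) (auto intro: weight_eqI)

lemma weyl_weight_add: "weyl_weight w (\<xi> + \<eta>) = weyl_weight w \<xi> + weyl_weight w \<eta>"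
proof -
  let ?A = "{i. coord \<xi> i \<noteq> 0} \<union> {i. coord \<eta> i \<noteq> 0}"
  have eq: "weyl_weight w \<zeta> = (\<Sum>i\<in>?A. coord \<zeta> i *\<^sub>w eps (w i))"
    if "{i. coord \<zeta> i \<noteq> 0} \<subseteq> ?A" for \<zeta>
    using that by (intro weyl_weight_superset) auto
  have "weyl_weight w (\<xi> + \<eta>) = (\<Sum>i\<in>?A. coord (\<xi> + \<eta>) i *\<^sub>w eps (w i))"
    by (rule eq) auto
  also have "\<dots> = (\<Sum>i\<in>?A. coord \<xi> i *\<^sub>w eps (w i) + coord \<eta> i *\<^sub>w eps (w i))"
    by (intro sum.cong refl weight_eqI) (simp add: algebra_simps)
  also have "\<dots> = weyl_weight w \<xi> + weyl_weight w \<eta>"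
    by (subst (1 2) eq) (auto simp: sum.distrib)
  finally show ?thesis .
qed

lemma weyl_weight_zero [simp]: "weyl_weight w 0 = 0"
  by (simp add: weyl_weight_def)

lemma weyl_weight_uminus: "weyl_weight w (- \<xi>) = - weyl_weight w \<xi>"
  by (metis add_eq_0_iff weyl_weight_add weyl_weight_zero add.right_inverse)

lemma weyl_weight_scale: "weyl_weight w (c *\<^sub>w \<xi>) = c *\<^sub>w weyl_weight w \<xi>"
proof -
  have "weyl_weight w (c *\<^sub>w \<xi>) = (\<Sum>i | coord \<xi> i \<noteq> 0. coord (c *\<^sub>w \<xi>) i *\<^sub>w eps (w i))"
    by (rule weyl_weight_superset) auto
  also have "\<dots> = c *\<^sub>w weyl_weight w \<xi>"
    unfolding weyl_weight_def
    by (rule weight_eqI) (simp add: coord_sum sum_distrib_left mult.assoc)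
  finally show ?thesis .
qed

lemma weyl_weight_eps [simp]: "weyl_weight w (eps i) = eps (w i)"
proof -
  have "weyl_weight w (eps i) = (\<Sum>j\<in>{i}. coord (eps i) j *\<^sub>w eps (w j))"
    by (rule weyl_weight_superset) auto
  also have "\<dots> = eps (w i)"
    by (auto intro: weight_eqI)
  finally show ?thesis .
qed

lemma coord_weyl_weight:
  assumes "inj w"
  shows "coord (weyl_weight w \<xi>) (w i) = coord \<xi> i"
proof -
  have "coord (weyl_weight w \<xi>) (w i) = (\<Sum>j | coord \<xi> j \<noteq> 0. if j = i then coord \<xi> j else 0)"
    unfolding weyl_weight_def coord_sum using assms
    by (intro sum.cong refl) (auto simp: inj_eq)
  also have "\<dots> = coord \<xi> i"
    by (subst sum.delta) auto
  finally show ?thesis .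
qed

lemma inj_weyl_weight: "inj w \<Longrightarrow> inj (weyl_weight w)"
  by (rule injI, rule weight_eqI) (metis coord_weyl_weight)

lemma weyl_alg_superset:
  assumes "finite A" "Poly_Mapping.keys f \<subseteq> A"
  shows "weyl_alg w f = (\<Sum>\<eta>\<in>A. Poly_Mapping.single (weyl_weight w \<eta>) (Poly_Mapping.lookup f \<eta>))"
  unfolding weyl_alg_def
  by (rule sum.mono_neutral_left[OF assms]) (auto simp: in_keys_iff)

lemma weyl_alg_add: "weyl_alg w (f + g) = weyl_alg w f + weyl_alg w g"
proof -
  let ?A = "Poly_Mapping.keys f \<union> Poly_Mapping.keys g"
  have eq: "weyl_alg w h = (\<Sum>\<eta>\<in>?A. Poly_Mapping.single (weyl_weight w \<eta>) (Poly_Mapping.lookup h \<eta>))"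
    if "Poly_Mapping.keys h \<subseteq> ?A" for h
    using that by (intro weyl_alg_superset) auto
  show ?thesis
    by (subst (1 2 3) eq) (auto simp: lookup_add single_add sum.distrib dest: subsetD[OF keys_add])
qed

lemma weyl_alg_zero [simp]: "weyl_alg w 0 = 0"
  by (simp add: weyl_alg_def)

lemma weyl_alg_sum: "weyl_alg w (sum f A) = (\<Sum>a\<in>A. weyl_alg w (f a))"
  by (induction A rule: infinite_finite_induct) (auto simp: weyl_alg_add)

lemma weyl_alg_single [simp]:
  "weyl_alg w (Poly_Mapping.single \<eta> c) = Poly_Mapping.single (weyl_weight w \<eta>) c"
proof -
  have "weyl_alg w (Poly_Mapping.single \<eta> c) =
      (\<Sum>\<zeta>\<in>{\<eta>}. Poly_Mapping.single (weyl_weight w \<zeta>) (Poly_Mapping.lookup (Poly_Mapping.single \<eta> c) \<zeta>))"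
    by (rule weyl_alg_superset) auto
  then show ?thesis
    by simp
qed

lemma weyl_alg_one [simp]: "weyl_alg w 1 = 1"
  using weyl_alg_single[of w 0 1] by simp

lemma group_alg_expand:
  "f = (\<Sum>\<eta>\<in>Poly_Mapping.keys f. Poly_Mapping.single \<eta> (Poly_Mapping.lookup f \<eta>))"
  by (rule poly_mapping_eqI)
    (auto simp: lookup_sum lookup_single when_def in_keys_iff sum.delta)

lemma weyl_alg_mult: "weyl_alg w (f * g) = weyl_alg w f * weyl_alg w g"
proof -
  have "f * g = (\<Sum>\<eta>\<in>Poly_Mapping.keys f. \<Sum>\<zeta>\<in>Poly_Mapping.keys g.
      Poly_Mapping.single (\<eta> + \<zeta>) (Poly_Mapping.lookup f \<eta> * Poly_Mapping.lookup g \<zeta>))"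
    by (subst group_alg_expand[of f], subst group_alg_expand[of g])
      (simp add: sum_product mult_single)
  then have "weyl_alg w (f * g) = (\<Sum>\<eta>\<in>Poly_Mapping.keys f. \<Sum>\<zeta>\<in>Poly_Mapping.keys g.
      Poly_Mapping.single (weyl_weight w \<eta> + weyl_weight w \<zeta>)
        (Poly_Mapping.lookup f \<eta> * Poly_Mapping.lookup g \<zeta>))"
    by (simp only: weyl_alg_sum weyl_alg_single weyl_weight_add)
  also have "\<dots> = weyl_alg w f * weyl_alg w g"
    by (simp add: weyl_alg_def sum_product mult_single)
  finally show ?thesis .
qed

lemma weyl_alg_eq_0_iff:
  assumes "inj w"
  shows "weyl_alg w f = 0 \<longleftrightarrow> f = 0"
proof
  assume *: "weyl_alg w f = 0"
  show "f = 0"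
  proof (rule poly_mapping_eqI)
    fix \<eta>
    have "Poly_Mapping.lookup (weyl_alg w f) (weyl_weight w \<eta>) =
        (\<Sum>\<zeta>\<in>Poly_Mapping.keys f. if \<zeta> = \<eta> then Poly_Mapping.lookup f \<zeta> else 0)"
      unfolding weyl_alg_def lookup_sum lookup_single
      by (intro sum.cong refl) (auto simp: when_def inj_eq[OF inj_weyl_weight[OF assms]])
    also have "\<dots> = Poly_Mapping.lookup f \<eta>"
      by (simp add: in_keys_iff)
    finally show "Poly_Mapping.lookup f \<eta> = Poly_Mapping.lookup 0 \<eta>"
      using * by simp
  qed
qed simp

text \<open>The extension to fractions exists only if the action on the group algebra is injective;
  for a map \<open>w\<close> that is not injective the value is irrelevant.\<close>

lift_definition weyl_field :: "(nat \<Rightarrow> nat) \<Rightarrow> exp_field \<Rightarrow> exp_field"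
  is "\<lambda>w (f, g). if inj w then (weyl_alg w f, weyl_alg w g) else (f, g)"
  by (auto simp: weyl_alg_eq_0_iff weyl_alg_mult[symmetric] split: if_splits)

lemma weyl_field_Fract:
  assumes "inj w" "g \<noteq> 0"
  shows "weyl_field w (Fraction_Field.Fract f g) = Fraction_Field.Fract (weyl_alg w f) (weyl_alg w g)"
proof -
  have "weyl_alg w g \<noteq> 0"
    using assms by (simp add: weyl_alg_eq_0_iff)
  with assms show ?thesis
    by (simp add: Fraction_Field.Fract.abs_eq weyl_field.abs_eq)
qed

lemma weyl_field_fexp: "inj w \<Longrightarrow> weyl_field w (fexp \<xi>) = fexp (weyl_weight w \<xi>)"
  by (simp add: fexp_def weyl_field_Fract)

lemma weyl_field_0: "inj w \<Longrightarrow> weyl_field w 0 = 0"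
  by (simp add: Zero_fract_def weyl_field_Fract)

lemma weyl_field_1: "inj w \<Longrightarrow> weyl_field w 1 = 1"
  by (simp add: One_fract_def weyl_field_Fract)

lemma weyl_field_add:
  assumes w: "inj w"
  shows "weyl_field w (x + y) = weyl_field w x + weyl_field w y"
proof -
  obtain a b where x: "x = Fraction_Field.Fract a b" "b \<noteq> 0"
    by (rule Fraction_Field.Fract_cases)
  obtain c d where y: "y = Fraction_Field.Fract c d" "d \<noteq> 0"
    by (rule Fraction_Field.Fract_cases)
  have nz: "weyl_alg w b \<noteq> 0" "weyl_alg w d \<noteq> 0" "b * d \<noteq> 0"
    using x y weyl_alg_eq_0_iff[OF w] by simp_all
  show ?thesis
    using nz unfolding x(1) y(1)
    by (simp only: Fraction_Field.add_fract[OF x(2) y(2)] Fraction_Field.add_fract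
        weyl_field_Fract[OF w] x(2) y(2) weyl_alg_add weyl_alg_mult not_False_eq_True)
qed

lemma weyl_field_mult:
  assumes w: "inj w"
  shows "weyl_field w (x * y) = weyl_field w x * weyl_field w y"
proof -
  obtain a b where x: "x = Fraction_Field.Fract a b" "b \<noteq> 0"
    by (rule Fraction_Field.Fract_cases)
  obtain c d where y: "y = Fraction_Field.Fract c d" "d \<noteq> 0"
    by (rule Fraction_Field.Fract_cases)
  have "b * d \<noteq> 0"
    using x y by simp
  then show ?thesis
    unfolding x(1) y(1)
    by (simp only: Fraction_Field.mult_fract weyl_field_Fract[OF w] x(2) y(2) weyl_alg_mult
        not_False_eq_True)
qed

lemma weyl_field_inverse: "inj w \<Longrightarrow> weyl_field w (inverse x) = inverse (weyl_field w x)"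
proof (cases "x = 0")
  case False
  assume w: "inj w"
  have "weyl_field w x * weyl_field w (inverse x) = 1"
    using False by (simp add: weyl_field_mult[OF w, symmetric] weyl_field_1[OF w])
  then show ?thesis
    by (rule inverse_unique[symmetric])
qed (simp add: weyl_field_0)

lemma fexp_0 [simp]: "fexp 0 = 1"
  by (simp add: fexp_def One_fract_def)

lemma fexp_add: "fexp (\<xi> + \<eta>) = fexp \<xi> * fexp \<eta>"
  by (simp add: fexp_def mult_single)

lemma fexp_inject: "fexp \<xi> = fexp \<eta> \<longleftrightarrow> \<xi> = \<eta>"
proof
  assume "fexp \<xi> = fexp \<eta>"
  then have "Poly_Mapping.single \<xi> (1 :: complex) = Poly_Mapping.single \<eta> 1"
    by (simp add: fexp_def eq_fract)
  then have "Poly_Mapping.keys (Poly_Mapping.single \<xi> (1 :: complex)) =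
      Poly_Mapping.keys (Poly_Mapping.single \<eta> (1 :: complex))"
    by (rule arg_cong)
  then show "\<xi> = \<eta>"
    by simp
qed simp


section \<open>The two sides of the denominator identity\<close>

definition rho :: "nat \<Rightarrow> weight" where
  "rho n = - (\<Sum>i = 1..n. of_nat i *\<^sub>w eps i)"

definition super_denominator :: "nat \<Rightarrow> exp_field" where
  "super_denominator n =
     (\<Prod>\<alpha> \<in> pos_even_roots n. 1 - fexp (- \<alpha>)) / (\<Prod>\<alpha> \<in> pos_odd_roots n. 1 - fexp (- \<alpha>))"

definition beta :: "nat \<Rightarrow> nat \<Rightarrow> weight" where
  "beta n k = 2 *\<^sub>w eps (n + 1 - k)"


section \<open>Explicit description of the roots\<close>

lemma periplectic_iff:
  "X \<in> periplectic n \<longleftrightarrow> X \<in> carrier_mat (2 * n) (2 * n) \<and>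
     (\<forall>i<n. \<forall>j<n. X $$ (n + i, n + j) = - X $$ (j, i) \<and> X $$ (i, n + j) = X $$ (j, n + i) \<and>
        X $$ (n + i, j) + X $$ (n + j, i) = 0)"
    (is "_ \<longleftrightarrow> ?R")
proof
  assume "X \<in> periplectic n"
  then obtain A B C where X: "X = four_block_mat A B C (- transpose_mat A)"
    and c: "A \<in> carrier_mat n n" "B \<in> carrier_mat n n" "C \<in> carrier_mat n n"
    and t: "transpose_mat B = B" "transpose_mat C = - C"
    unfolding periplectic_def by blast
  have B: "B $$ (i, j) = B $$ (j, i)" if "i < n" "j < n" for i j
  proof -
    have "transpose_mat B $$ (i, j) = B $$ (j, i)"
      using that c by (intro index_transpose_mat(1)) auto
    then show ?thesis
      by (simp only: t(1))
  qed
  have C: "C $$ (i, j) + C $$ (j, i) = 0" if "i < n" "j < n" for i j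
  proof -
    have "C $$ (i, j) = transpose_mat C $$ (j, i)"
      using that c by (intro index_transpose_mat(1)[symmetric]) auto
    also have "\<dots> = - C $$ (j, i)"
      unfolding t(2) using that c by (intro index_uminus_mat(1)) auto
    finally show ?thesis
      by (simp only: add.left_inverse)
  qed
  have "X \<in> carrier_mat (2 * n) (2 * n)"
    unfolding X using c by (intro carrier_matI) auto
  moreover have "X $$ (n + i, n + j) = - X $$ (j, i)" "X $$ (i, n + j) = X $$ (j, n + i)"
      "X $$ (n + i, j) + X $$ (n + j, i) = 0" if "i < n" "j < n" for i j
    using that c B[OF that(1,2)] C[OF that(1,2)] unfolding X by simp_all
  ultimately show ?R
    by blast
next
  assume R: ?R
  then have c: "dim_row X = 2 * n" "dim_col X = 2 * n"
    by auto
  define A where "A = mat n n (\<lambda>(i, j). X $$ (i, j))"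
  define B where "B = mat n n (\<lambda>(i, j). X $$ (i, n + j))"
  define C where "C = mat n n (\<lambda>(i, j). X $$ (n + i, j))"
  have "X = four_block_mat A B C (- transpose_mat A)"
  proof (rule eq_matI)
    fix r s
    assume "r < dim_row (four_block_mat A B C (- transpose_mat A))"
      and "s < dim_col (four_block_mat A B C (- transpose_mat A))"
    then have rs: "r < n + n" "s < n + n"
      by (auto simp: A_def)
    show "X $$ (r, s) = four_block_mat A B C (- transpose_mat A) $$ (r, s)"
    proof (cases "r < n"; cases "s < n")
      assume "\<not> r < n" "\<not> s < n"
      then obtain i j where ij: "r = n + i" "s = n + j" "i < n" "j < n"
        using rs by (metis add_less_cancel_left le_Suc_ex not_less)
      moreover have "X $$ (n + i, n + j) = - X $$ (j, i)"
        using R ij by blast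
      ultimately show ?thesis
        by (simp add: A_def)
    qed (use rs in \<open>auto simp: A_def B_def C_def\<close>)
  qed (auto simp: A_def c)
  moreover have "transpose_mat B = B"
    using R by (intro eq_matI) (simp_all add: B_def)
  moreover have "transpose_mat C = - C"
    using R by (intro eq_matI) (simp_all add: C_def eq_neg_iff_add_eq_0)
  moreover have "A \<in> carrier_mat n n" "B \<in> carrier_mat n n" "C \<in> carrier_mat n n"
    by (simp_all add: A_def B_def C_def)
  ultimately show "X \<in> periplectic n"
    unfolding periplectic_def by blast
qed

lemma periplectic_0_iff:
  "X \<in> periplectic_0 n \<longleftrightarrow> X \<in> periplectic n \<and>
     (\<forall>i<n. \<forall>j<n. X $$ (i, n + j) = 0 \<and> X $$ (n + i, j) = 0)"
proof -
  have "\<exists>A D. A \<in> carrier_mat n n \<and> D \<in> carrier_mat n n \<and>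
      X = four_block_mat A (0\<^sub>m n n) (0\<^sub>m n n) D"
    if "X \<in> periplectic n" and z: "\<forall>i<n. \<forall>j<n. X $$ (i, n + j) = 0 \<and> X $$ (n + i, j) = 0"
  proof -
    from that(1) obtain A B C where X: "X = four_block_mat A B C (- transpose_mat A)"
      and c: "A \<in> carrier_mat n n" "B \<in> carrier_mat n n" "C \<in> carrier_mat n n"
      unfolding periplectic_def by blast
    have "B = 0\<^sub>m n n" "C = 0\<^sub>m n n"
      using z c by (auto simp: X intro!: eq_matI)
    then show ?thesis
      using c X by (intro exI[of _ A] exI[of _ "- transpose_mat A"]) auto
  qed
  then show ?thesis
    unfolding periplectic_0_def by auto
qed

lemma periplectic_1_iff:
  "X \<in> periplectic_1 n \<longleftrightarrow> X \<in> periplectic n \<and>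
     (\<forall>i<n. \<forall>j<n. X $$ (i, j) = 0 \<and> X $$ (n + i, j) = 0)"
proof -
  have "\<exists>B\<in>carrier_mat n n. X = four_block_mat (0\<^sub>m n n) B (0\<^sub>m n n) (0\<^sub>m n n)"
    if "X \<in> periplectic n" and z: "\<forall>i<n. \<forall>j<n. X $$ (i, j) = 0 \<and> X $$ (n + i, j) = 0"
  proof -
    from that(1) obtain A B C where X: "X = four_block_mat A B C (- transpose_mat A)"
      and c: "A \<in> carrier_mat n n" "B \<in> carrier_mat n n" "C \<in> carrier_mat n n"
      unfolding periplectic_def by blast
    have "A = 0\<^sub>m n n" "C = 0\<^sub>m n n"
      using z c by (auto simp: X intro!: eq_matI)
    moreover from this have "- transpose_mat A = 0\<^sub>m n n"
      by (auto intro!: eq_matI)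
    ultimately show ?thesis
      using c X by auto
  qed
  then show ?thesis
    unfolding periplectic_1_def by auto
qed

lemma periplectic_m1_iff:
  "X \<in> periplectic_m1 n \<longleftrightarrow> X \<in> periplectic n \<and>
     (\<forall>i<n. \<forall>j<n. X $$ (i, j) = 0 \<and> X $$ (i, n + j) = 0)"
proof -
  have "\<exists>C\<in>carrier_mat n n. X = four_block_mat (0\<^sub>m n n) (0\<^sub>m n n) C (0\<^sub>m n n)"
    if "X \<in> periplectic n" and z: "\<forall>i<n. \<forall>j<n. X $$ (i, j) = 0 \<and> X $$ (i, n + j) = 0"
  proof -
    from that(1) obtain A B C where X: "X = four_block_mat A B C (- transpose_mat A)"
      and c: "A \<in> carrier_mat n n" "B \<in> carrier_mat n n" "C \<in> carrier_mat n n"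
      unfolding periplectic_def by blast
    have "A = 0\<^sub>m n n" "B = 0\<^sub>m n n"
      using z c by (auto simp: X intro!: eq_matI)
    moreover from this have "- transpose_mat A = 0\<^sub>m n n"
      by (auto intro!: eq_matI)
    ultimately show ?thesis
      using c X by auto
  qed
  then show ?thesis
    unfolding periplectic_m1_def by auto
qed

text \<open>The weight of the basis vector of \<open>V\<close> with index \<open>r\<close>.\<close>

definition index_weight :: "nat \<Rightarrow> nat \<Rightarrow> weight" where
  "index_weight n r = (if r < n then eps (r + 1) else - eps (r - n + 1))"

lemma weight_eval_minus [simp]: "weight_eval n (\<alpha> - \<gamma>) H = weight_eval n \<alpha> H - weight_eval n \<gamma> H"
  by (simp add: weight_eval_def algebra_simps sum_subtractf)

lemma weight_eval_uminus [simp]: "weight_eval n (- \<alpha>) H = - weight_eval n \<alpha> H"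
  by (simp add: weight_eval_def sum_negf)

lemma weight_eval_eps: "1 \<le> k \<Longrightarrow> k \<le> n \<Longrightarrow> weight_eval n (eps k) H = H $$ (k - 1, k - 1)"
proof -
  assume k: "1 \<le> k" "k \<le> n"
  have "weight_eval n (eps k) H = (\<Sum>i = 1..n. if i = k then H $$ (i - 1, i - 1) else 0)"
    unfolding weight_eval_def by (intro sum.cong refl) simp
  then show ?thesis
    using k by simp
qed

lemma weight_eval_index_weight:
  assumes "H \<in> cartan n" "r < 2 * n"
  shows "weight_eval n (index_weight n r) H = H $$ (r, r)"
proof (cases "r < n")
  case False
  then obtain i where i: "r = n + i" "i < n"
    using assms(2) by (metis add_less_cancel_left le_Suc_ex mult_2 not_less)
  then show ?thesis
    using assms(1) by (simp add: index_weight_def weight_eval_eps cartan_def periplectic_iff)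
qed (simp add: index_weight_def weight_eval_eps)

lemma index_weight_in_cartan_dual: "r < 2 * n \<Longrightarrow> index_weight n r \<in> cartan_dual n"
  by (auto simp: index_weight_def cartan_dual_def)

lemma weight_eval_inject:
  assumes "\<alpha> \<in> cartan_dual n" "\<gamma> \<in> cartan_dual n"
    and "\<And>H. H \<in> cartan n \<Longrightarrow> weight_eval n \<alpha> H = weight_eval n \<gamma> H"
  shows "\<alpha> = \<gamma>"
proof (rule weight_eqI)
  fix k
  show "coord \<alpha> k = coord \<gamma> k"
  proof (cases "k \<in> {1..n}")
    case True
    define H :: "complex mat" where "H = mat (2 * n) (2 * n) (\<lambda>(r, s).
      if r = s \<and> r = k - 1 then 1 else if r = s \<and> r = n + (k - 1) then - 1 else 0)"
    have "H \<in> cartan n"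
      using True by (auto simp: H_def cartan_def periplectic_iff diagonal_mat_def)
    moreover have "weight_eval n \<xi> H = coord \<xi> k" for \<xi>
    proof -
      have "weight_eval n \<xi> H = (\<Sum>i = 1..n. if i = k then coord \<xi> i else 0)"
        unfolding weight_eval_def
      proof (intro sum.cong refl)
        fix i
        assume i: "i \<in> {1..n}"
        then have "i - 1 < 2 * n" "i - 1 \<noteq> n + (k - 1)"
          by auto
        then have "H $$ (i - 1, i - 1) = (if i - 1 = k - 1 then 1 else 0)"
          unfolding H_def by (subst index_mat(1)) auto
        moreover have "i - 1 = k - 1 \<longleftrightarrow> i = k"
          using i True by auto
        ultimately show "coord \<xi> i * H $$ (i - 1, i - 1) = (if i = k then coord \<xi> i else 0)"
          by simp
      qed
      then show ?thesis
        using True by simp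
    qed
    ultimately show ?thesis
      using assms(3) by metis
  qed (use assms(1,2) in \<open>auto simp: cartan_dual_def\<close>)
qed

lemma cartan_commutator:
  assumes H: "H \<in> cartan n" and X: "X \<in> carrier_mat (2 * n) (2 * n)" and rs: "r < 2 * n" "s < 2 * n"
  shows "(H * X - X * H) $$ (r, s) = (H $$ (r, r) - H $$ (s, s)) * X $$ (r, s)"
proof -
  have Hc: "H \<in> carrier_mat (2 * n) (2 * n)" and d: "diagonal_mat H"
    using H by (auto simp: cartan_def periplectic_iff)
  have off: "H $$ (i, j) = 0" if "i < 2 * n" "j < 2 * n" "i \<noteq> j" for i j
    using d Hc that by (auto simp: diagonal_mat_def)
  have "(H * X) $$ (r, s) = (\<Sum>k = 0..<2 * n. H $$ (r, k) * X $$ (k, s))"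
    using Hc X rs by (simp add: scalar_prod_def)
  also have "\<dots> = (\<Sum>k = 0..<2 * n. if k = r then H $$ (r, r) * X $$ (r, s) else 0)"
    using off rs by (intro sum.cong refl) auto
  finally have 1: "(H * X) $$ (r, s) = H $$ (r, r) * X $$ (r, s)"
    using rs by simp
  have "(X * H) $$ (r, s) = (\<Sum>k = 0..<2 * n. X $$ (r, k) * H $$ (k, s))"
    using Hc X rs by (simp add: scalar_prod_def)
  also have "\<dots> = (\<Sum>k = 0..<2 * n. if k = s then X $$ (r, s) * H $$ (s, s) else 0)"
    using off rs by (intro sum.cong refl) auto
  finally have 2: "(X * H) $$ (r, s) = X $$ (r, s) * H $$ (s, s)"
    using rs by simp
  have "(H * X - X * H) $$ (r, s) = (H * X) $$ (r, s) - (X * H) $$ (r, s)"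
    using Hc X rs by (intro index_minus_mat(1)) auto
  then show ?thesis
    by (simp only: 1 2) (simp add: algebra_simps)
qed

lemma root_space_iff:
  assumes S: "S \<subseteq> periplectic n" and \<alpha>: "\<alpha> \<in> cartan_dual n"
  shows "X \<in> root_space n S \<alpha> \<longleftrightarrow> X \<in> S \<and>
    (\<forall>r<2 * n. \<forall>s<2 * n. X $$ (r, s) \<noteq> 0 \<longrightarrow> index_weight n r - index_weight n s = \<alpha>)"
proof (cases "X \<in> S")
  case True
  then have X: "X \<in> carrier_mat (2 * n) (2 * n)"
    using S by (auto simp: periplectic_iff)
  have iw: "index_weight n r - index_weight n s \<in> cartan_dual n" if "r < 2 * n" "s < 2 * n" for r s
    using index_weight_in_cartan_dual[OF that(1)] index_weight_in_cartan_dual[OF that(2)]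
    by (simp add: cartan_dual_def)
  have diff: "H $$ (r, r) - H $$ (s, s) = weight_eval n (index_weight n r - index_weight n s) H"
    if "H \<in> cartan n" "r < 2 * n" "s < 2 * n" for H r s
    using that by (simp add: weight_eval_index_weight)
  have "(\<forall>H\<in>cartan n. H * X - X * H = weight_eval n \<alpha> H \<cdot>\<^sub>m X) \<longleftrightarrow>
      (\<forall>H\<in>cartan n. \<forall>r<2 * n. \<forall>s<2 * n.
         weight_eval n (index_weight n r - index_weight n s) H * X $$ (r, s) =
         weight_eval n \<alpha> H * X $$ (r, s))" (is "?L \<longleftrightarrow> ?M")
  proof (intro ball_cong refl)
    fix H
    assume H: "H \<in> cartan n"
    then have Hc: "H \<in> carrier_mat (2 * n) (2 * n)"
      by (auto simp: cartan_def periplectic_iff)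
    have "H * X - X * H = weight_eval n \<alpha> H \<cdot>\<^sub>m X \<longleftrightarrow>
        (\<forall>r<2 * n. \<forall>s<2 * n. (H * X - X * H) $$ (r, s) = (weight_eval n \<alpha> H \<cdot>\<^sub>m X) $$ (r, s))"
      using Hc X by (subst mat_eq_iff) auto
    also have "\<dots> \<longleftrightarrow> (\<forall>r<2 * n. \<forall>s<2 * n.
         weight_eval n (index_weight n r - index_weight n s) H * X $$ (r, s) =
         weight_eval n \<alpha> H * X $$ (r, s))"
      using X by (simp only: cartan_commutator[OF H X] diff[OF H] index_smult_mat(1) carrier_matD cong: imp_cong)
    finally show "H * X - X * H = weight_eval n \<alpha> H \<cdot>\<^sub>m X \<longleftrightarrow> (\<forall>r<2 * n. \<forall>s<2 * n.
         weight_eval n (index_weight n r - index_weight n s) H * X $$ (r, s) =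
         weight_eval n \<alpha> H * X $$ (r, s))" .
  qed
  also have "\<dots> \<longleftrightarrow>
      (\<forall>r<2 * n. \<forall>s<2 * n. X $$ (r, s) \<noteq> 0 \<longrightarrow> index_weight n r - index_weight n s = \<alpha>)"
  proof
    assume M: ?M
    show "\<forall>r<2 * n. \<forall>s<2 * n. X $$ (r, s) \<noteq> 0 \<longrightarrow> index_weight n r - index_weight n s = \<alpha>"
    proof (intro allI impI)
      fix r s
      assume rs: "r < 2 * n" "s < 2 * n" "X $$ (r, s) \<noteq> 0"
      show "index_weight n r - index_weight n s = \<alpha>"
      proof (rule weight_eval_inject[OF iw[OF rs(1,2)] \<alpha>])
        fix H
        assume "H \<in> cartan n"
        then have "weight_eval n (index_weight n r - index_weight n s) H * X $$ (r, s) =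
            weight_eval n \<alpha> H * X $$ (r, s)"
          using M rs(1,2) by blast
        then show "weight_eval n (index_weight n r - index_weight n s) H = weight_eval n \<alpha> H"
          using rs(3) mult_right_cancel by blast
      qed
    qed
  next
    assume *: "\<forall>r<2 * n. \<forall>s<2 * n. X $$ (r, s) \<noteq> 0 \<longrightarrow> index_weight n r - index_weight n s = \<alpha>"
    show ?M
    proof (intro ballI allI impI)
      fix H r s
      assume "r < 2 * n" "s < 2 * n"
      then show "weight_eval n (index_weight n r - index_weight n s) H * X $$ (r, s) =
          weight_eval n \<alpha> H * X $$ (r, s)"
        using * by (cases "X $$ (r, s) = 0") (simp_all del: weight_eval_minus)
    qed
  qed
  finally show ?thesis
    using True by (simp add: root_space_def)
qed (simp add: root_space_def)

lemma roots_ofI: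
  assumes "S \<subseteq> periplectic n" "\<alpha> \<noteq> 0" "X \<in> S" "r < 2 * n" "s < 2 * n" "X $$ (r, s) \<noteq> 0"
    and "\<And>r s. r < 2 * n \<Longrightarrow> s < 2 * n \<Longrightarrow> X $$ (r, s) \<noteq> 0 \<Longrightarrow> index_weight n r - index_weight n s = \<alpha>"
  shows "\<alpha> \<in> roots_of n S"
proof -
  have "\<alpha> \<in> cartan_dual n"
    using assms(7)[OF assms(4-6)] index_weight_in_cartan_dual[OF assms(4)]
      index_weight_in_cartan_dual[OF assms(5)] by (auto simp: cartan_dual_def)
  moreover have "X \<in> root_space n S \<alpha>"
    using assms by (subst root_space_iff[OF assms(1) calculation]) auto
  moreover have "X \<noteq> 0\<^sub>m (2 * n) (2 * n)"
    using assms by auto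
  ultimately show ?thesis
    using assms(2) by (auto simp: roots_of_def)
qed

lemma roots_ofE:
  assumes S: "S \<subseteq> periplectic n" and "\<alpha> \<in> roots_of n S"
  obtains X r s where "X \<in> S" "r < 2 * n" "s < 2 * n" "X $$ (r, s) \<noteq> 0" "\<alpha> \<noteq> 0"
    "\<alpha> = index_weight n r - index_weight n s"
proof -
  obtain X where \<alpha>: "\<alpha> \<in> cartan_dual n" "\<alpha> \<noteq> 0"
    and X: "X \<in> root_space n S \<alpha>" "X \<noteq> 0\<^sub>m (2 * n) (2 * n)"
    using assms(2) by (auto simp: roots_of_def)
  have XS: "X \<in> S" "\<forall>r<2 * n. \<forall>s<2 * n. X $$ (r, s) \<noteq> 0 \<longrightarrow> index_weight n r - index_weight n s = \<alpha>"
    using X(1) root_space_iff[OF S \<alpha>(1)] by auto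
  have "X \<in> carrier_mat (2 * n) (2 * n)"
    using XS(1) S by (auto simp: periplectic_iff)
  then obtain r s where "r < 2 * n" "s < 2 * n" "X $$ (r, s) \<noteq> 0"
    using X(2) by (auto simp: mat_eq_iff)
  then show thesis
    using that XS \<alpha>(2) by blast
qed

lemma periplectic_1_zero:
  assumes "X \<in> periplectic_1 n" "i < n" "j < n"
  shows "X $$ (i, j) = 0" "X $$ (n + i, j) = 0" "X $$ (n + i, n + j) = 0"
proof -
  have "X \<in> periplectic n"
    and z: "\<And>i j. i < n \<Longrightarrow> j < n \<Longrightarrow> X $$ (i, j) = 0 \<and> X $$ (n + i, j) = 0"
    using assms(1) unfolding periplectic_1_iff by blast+
  then have "X $$ (n + i, n + j) = - X $$ (j, i)"
    using assms(2,3) unfolding periplectic_iff by blast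
  then show "X $$ (i, j) = 0" "X $$ (n + i, j) = 0" "X $$ (n + i, n + j) = 0"
    using z[OF assms(2,3)] z[OF assms(3,2)] by simp_all
qed

lemma periplectic_m1_zero:
  assumes "X \<in> periplectic_m1 n" "i < n" "j < n"
  shows "X $$ (i, j) = 0" "X $$ (i, n + j) = 0" "X $$ (n + i, n + j) = 0"
proof -
  have "X \<in> periplectic n"
    and z: "\<And>i j. i < n \<Longrightarrow> j < n \<Longrightarrow> X $$ (i, j) = 0 \<and> X $$ (i, n + j) = 0"
    using assms(1) unfolding periplectic_m1_iff by blast+
  then have "X $$ (n + i, n + j) = - X $$ (j, i)"
    using assms(2,3) unfolding periplectic_iff by blast
  then show "X $$ (i, j) = 0" "X $$ (i, n + j) = 0" "X $$ (n + i, n + j) = 0"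
    using z[OF assms(2,3)] z[OF assms(3,2)] by simp_all
qed

lemma periplectic_0_zero:
  assumes "X \<in> periplectic_0 n" "i < n" "j < n"
  shows "X $$ (i, n + j) = 0" "X $$ (n + i, j) = 0"
  using assms unfolding periplectic_0_iff by blast+

lemma double_index_cases:
  fixes r n :: nat
  assumes "r < 2 * n"
  obtains i where "i < n" "r = i" | i where "i < n" "r = n + i"
proof (cases "r < n")
  case False
  then have "r - n < n" "r = n + (r - n)"
    using assms by auto
  then show thesis
    by (rule that(2))
qed (use that(1) in blast)

lemma index_weight_simps [simp]:
  "i < n \<Longrightarrow> index_weight n i = eps (i + 1)" "index_weight n (n + i) = - eps (i + 1)"
  "index_weight n (i + n) = - eps (i + 1)"
  by (simp_all add: index_weight_def)

lemma weight_neqI: "coord \<alpha> k \<noteq> coord \<gamma> k \<Longrightarrow> \<alpha> \<noteq> \<gamma>"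
  by auto

lemma roots_of_periplectic_1:
  "roots_of n (periplectic_1 n) = {eps i + eps j | i j. 1 \<le> i \<and> i \<le> j \<and> j \<le> n}"
proof (intro equalityI subsetI)
  have S: "periplectic_1 n \<subseteq> periplectic n"
    by (auto simp: periplectic_1_def)
  fix \<alpha>
  {
    assume "\<alpha> \<in> roots_of n (periplectic_1 n)"
    then obtain X r s where X: "X \<in> periplectic_1 n" "r < 2 * n" "s < 2 * n" "X $$ (r, s) \<noteq> 0"
      and \<alpha>: "\<alpha> = index_weight n r - index_weight n s"
      by (rule roots_ofE[OF S])
    obtain i j where ij: "i < n" "j < n" "r = i" "s = n + j"
      using X by (cases rule: double_index_cases[OF X(2)]; cases rule: double_index_cases[OF X(3)])
        (simp_all add: periplectic_1_zero)
    have eq: "\<alpha> = eps (min i j + 1) + eps (max i j + 1)"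
      using ij by (simp add: \<alpha> min_def max_def add.commute)
    show "\<alpha> \<in> {eps i + eps j | i j. 1 \<le> i \<and> i \<le> j \<and> j \<le> n}"
      by (intro CollectI exI[of _ "min i j + 1"] exI[of _ "max i j + 1"] conjI eq)
        (use ij in simp_all)
  next
    assume "\<alpha> \<in> {eps i + eps j | i j. 1 \<le> i \<and> i \<le> j \<and> j \<le> n}"
    then obtain i j where ij: "1 \<le> i" "i \<le> j" "j \<le> n" and \<alpha>: "\<alpha> = eps i + eps j"
      by blast
    define a b where "a = i - 1" and "b = j - 1"
    have ab: "i = a + 1" "j = b + 1" "a < n" "b < n"
      using ij by (auto simp: a_def b_def)
    define X :: "complex mat" where "X = mat (2 * n) (2 * n)
      (\<lambda>(r, s). if (r, s) = (a, n + b) \<or> (r, s) = (b, n + a) then 1 else 0)"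
    show "\<alpha> \<in> roots_of n (periplectic_1 n)"
    proof (rule roots_ofI[OF S])
      show "\<alpha> \<noteq> 0"
        by (rule weight_neqI[of _ i]) (simp add: \<alpha>)
      show "X \<in> periplectic_1 n"
        using ab by (auto simp: X_def periplectic_1_iff periplectic_iff)
      show "a < 2 * n" "n + b < 2 * n" "X $$ (a, n + b) \<noteq> 0"
        using ab by (auto simp: X_def)
      show "index_weight n r - index_weight n s = \<alpha>"
        if "r < 2 * n" "s < 2 * n" "X $$ (r, s) \<noteq> 0" for r s
        using that ab by (auto simp: X_def \<alpha> add.commute split: if_splits)
    qed
  }
qed

lemma roots_of_periplectic_m1:
  "roots_of n (periplectic_m1 n) = {- (eps i + eps j) | i j. 1 \<le> i \<and> i < j \<and> j \<le> n}"
proof (intro equalityI subsetI)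
  have S: "periplectic_m1 n \<subseteq> periplectic n"
    by (auto simp: periplectic_m1_def)
  fix \<alpha>
  {
    assume "\<alpha> \<in> roots_of n (periplectic_m1 n)"
    then obtain X r s where X: "X \<in> periplectic_m1 n" "r < 2 * n" "s < 2 * n" "X $$ (r, s) \<noteq> 0"
      and \<alpha>: "\<alpha> = index_weight n r - index_weight n s"
      by (rule roots_ofE[OF S])
    obtain i j where ij: "i < n" "j < n" "r = n + i" "s = j"
      using X by (cases rule: double_index_cases[OF X(2)]; cases rule: double_index_cases[OF X(3)])
        (simp_all add: periplectic_m1_zero)
    have "i \<noteq> j"
    proof
      assume "i = j"
      then have "X $$ (n + i, i) + X $$ (n + i, i) = 0"
        using X(1) ij by (simp only: periplectic_m1_iff periplectic_iff)
      then show False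
        using X(4) ij \<open>i = j\<close> by simp
    qed
    have eq: "\<alpha> = - (eps (min i j + 1) + eps (max i j + 1))"
      using ij by (simp add: \<alpha> min_def max_def)
    show "\<alpha> \<in> {- (eps i + eps j) | i j. 1 \<le> i \<and> i < j \<and> j \<le> n}"
      by (intro CollectI exI[of _ "min i j + 1"] exI[of _ "max i j + 1"] conjI eq)
        (use ij \<open>i \<noteq> j\<close> in simp_all)
  next
    assume "\<alpha> \<in> {- (eps i + eps j) | i j. 1 \<le> i \<and> i < j \<and> j \<le> n}"
    then obtain i j where ij: "1 \<le> i" "i < j" "j \<le> n" and \<alpha>: "\<alpha> = - (eps i + eps j)"
      by blast
    define a b where "a = i - 1" and "b = j - 1"
    have ab: "i = a + 1" "j = b + 1" "a < n" "b < n" "a \<noteq> b"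
      using ij by (auto simp: a_def b_def)
    define X :: "complex mat" where "X = mat (2 * n) (2 * n)
      (\<lambda>(r, s). if (r, s) = (n + a, b) then 1 else if (r, s) = (n + b, a) then - 1 else 0)"
    show "\<alpha> \<in> roots_of n (periplectic_m1 n)"
    proof (rule roots_ofI[OF S])
      show "\<alpha> \<noteq> 0"
        using ij by (intro weight_neqI[of _ i]) (simp add: \<alpha>)
      show "X \<in> periplectic_m1 n"
        using ab by (auto simp: X_def periplectic_m1_iff periplectic_iff)
      show "n + a < 2 * n" "b < 2 * n" "X $$ (n + a, b) \<noteq> 0"
        using ab by (auto simp: X_def)
      show "index_weight n r - index_weight n s = \<alpha>"
        if "r < 2 * n" "s < 2 * n" "X $$ (r, s) \<noteq> 0" for r s
        using that ab by (auto simp: X_def \<alpha> algebra_simps split: if_splits)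
    qed
  }
qed

lemma roots_of_periplectic_0:
  "roots_of n (periplectic_0 n) = {eps i - eps j | i j. i \<in> {1..n} \<and> j \<in> {1..n} \<and> i \<noteq> j}"
proof (intro equalityI subsetI)
  have S: "periplectic_0 n \<subseteq> periplectic n"
    by (auto simp: periplectic_0_def)
  fix \<alpha>
  {
    assume "\<alpha> \<in> roots_of n (periplectic_0 n)"
    then obtain X r s where X: "X \<in> periplectic_0 n" "r < 2 * n" "s < 2 * n" "X $$ (r, s) \<noteq> 0"
      and \<alpha>: "\<alpha> \<noteq> 0" "\<alpha> = index_weight n r - index_weight n s"
      by (rule roots_ofE[OF S])
    obtain i j where ij: "i < n" "j < n" "\<alpha> = eps (i + 1) - eps (j + 1)"
      using X by (cases rule: double_index_cases[OF X(2)]; cases rule: double_index_cases[OF X(3)])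
        (auto simp: \<alpha>(2) periplectic_0_zero)
    moreover have "i \<noteq> j"
      using ij \<alpha>(1) by auto
    ultimately show "\<alpha> \<in> {eps i - eps j | i j. i \<in> {1..n} \<and> j \<in> {1..n} \<and> i \<noteq> j}"
      by force
  next
    assume "\<alpha> \<in> {eps i - eps j | i j. i \<in> {1..n} \<and> j \<in> {1..n} \<and> i \<noteq> j}"
    then obtain i j where ij: "i \<in> {1..n}" "j \<in> {1..n}" "i \<noteq> j" and \<alpha>: "\<alpha> = eps i - eps j"
      by blast
    define a b where "a = i - 1" and "b = j - 1"
    have ab: "i = a + 1" "j = b + 1" "a < n" "b < n" "a \<noteq> b"
      using ij by (auto simp: a_def b_def)
    define X :: "complex mat" where "X = mat (2 * n) (2 * n)
      (\<lambda>(r, s). if (r, s) = (a, b) then 1 else if (r, s) = (n + b, n + a) then - 1 else 0)"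
    show "\<alpha> \<in> roots_of n (periplectic_0 n)"
    proof (rule roots_ofI[OF S])
      show "\<alpha> \<noteq> 0"
        using ij by (intro weight_neqI[of _ i]) (simp add: \<alpha>)
      show "X \<in> periplectic_0 n"
        using ab by (auto simp: X_def periplectic_0_iff periplectic_iff)
      show "a < 2 * n" "b < 2 * n" "X $$ (a, b) \<noteq> 0"
        using ab by (auto simp: X_def)
      show "index_weight n r - index_weight n s = \<alpha>"
        if "r < 2 * n" "s < 2 * n" "X $$ (r, s) \<noteq> 0" for r s
        using that ab by (auto simp: X_def \<alpha> algebra_simps split: if_splits)
    qed
  }
qed

lemma pos_odd_roots_eq: "pos_odd_roots n = {eps i + eps j | i j. 1 \<le> i \<and> i \<le> j \<and> j \<le> n}"
  by (simp add: pos_odd_roots_def roots_of_periplectic_1)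

lemma pos_even_roots_subset: "pos_even_roots n \<subseteq> roots_of n (periplectic_0 n)"
proof
  fix \<alpha>
  assume "\<alpha> \<in> pos_even_roots n"
  then obtain i j where "\<alpha> = eps i - eps j" "1 \<le> i" "i < j" "j \<le> n"
    by (auto simp: pos_even_roots_def)
  moreover from this have "i \<in> {1..n}" "j \<in> {1..n}" "i \<noteq> j"
    by auto
  ultimately show "\<alpha> \<in> roots_of n (periplectic_0 n)"
    unfolding roots_of_periplectic_0 by blast
qed

end

theory Submission
  imports Defs "HOL-Computational_Algebra.Polynomial"
begin

text \<open>Put \<open>x\<^sub>i = e\<^bsup>-\<epsilon>\<^sub>i\<^esup>\<close> and \<open>F z = z / (1 - z\<^sup>2)\<close>. The summand on the right-hand side is
  \<open>F (x\<^sub>1 \<cdots> x\<^sub>n) F (x\<^sub>2 \<cdots> x\<^sub>n) \<cdots> F (x\<^sub>n)\<close>, and the left-hand side is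
  \<open>\<Prod>\<^sub>j F (x\<^sub>j) \<cdot> \<Prod>\<^sub>i\<^sub><\<^sub>j g (x\<^sub>i, x\<^sub>j)\<close> with the antisymmetric function \<open>g (u, v) = (v - u) / (1 - u v)\<close>.
  The first factor of the summand is symmetric, and the others do not involve the variable placed at
  position \<open>1\<close>. Splitting the alternating sum according to that variable and using induction
  on the number of variables reduces the identity to
  \<open>\<Sum>\<^sub>i (1 - x\<^sub>i\<^sup>2) \<Prod>\<^bsub>j\<noteq>i\<^esub> x\<^sub>j (1 - x\<^sub>i x\<^sub>j) / (x\<^sub>j - x\<^sub>i) = 1 - (x\<^sub>1 \<cdots> x\<^sub>n)\<^sup>2\<close>,
  which is Lagrange interpolation at the nodes \<open>x\<^sub>i\<close>, evaluated at \<open>0\<close>, of the polynomial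
  \<open>\<Prod>\<^sub>j (1 - t x\<^sub>j)\<close>.\<close>

section \<open>Lagrange interpolation at zero\<close>

text \<open>Some \<open>b i\<close> may vanish (a node may be 0), so the coefficient at
  \<open>card A\<close> is recorded, which need not be the leading one.\<close>

lemma prod_linear_polys:
  fixes a b :: "'i \<Rightarrow> 'a :: comm_ring_1"
  assumes "finite A"
  shows degree_prod_linear_polys_le: "degree (\<Prod>i\<in>A. [:a i, b i:]) \<le> card A"
    and coeff_prod_linear_polys_card: "coeff (\<Prod>i\<in>A. [:a i, b i:]) (card A) = (\<Prod>i\<in>A. b i)"
proof -
  have "degree (\<Prod>i\<in>A. [:a i, b i:]) \<le> card A \<and>
    coeff (\<Prod>i\<in>A. [:a i, b i:]) (card A) = (\<Prod>i\<in>A. b i)"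
    using assms
  proof (induction A)
    case (insert i A)
    let ?p = "\<Prod>i\<in>A. [:a i, b i:]"
    have "degree ([:a i, b i:] * ?p) \<le> Suc (card A)"
      using degree_mult_le[of "[:a i, b i:]" ?p] degree_pCons_le[of "a i" "[:b i:]"] insert.IH
      by simp
    moreover have "coeff ([:a i, b i:] * ?p) (Suc (card A)) = b i * (\<Prod>i\<in>A. b i)"
      using insert.IH by (simp add: coeff_eq_0)
    ultimately show ?case
      using insert.hyps by simp
  qed simp
  then show "degree (\<Prod>i\<in>A. [:a i, b i:]) \<le> card A"
    and "coeff (\<Prod>i\<in>A. [:a i, b i:]) (card A) = (\<Prod>i\<in>A. b i)"
    by blast+
qed

lemma sum_lagrange_at_zero:
  fixes A :: "'a :: field set"
  assumes A: "finite A"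
  shows "(\<Sum>u\<in>A. (1 - u\<^sup>2) * (\<Prod>v\<in>A - {u}. v * (1 - u * v) / (v - u))) = 1 - (\<Prod>A)\<^sup>2"
proof -
  txt \<open>\<open>L\<close> interpolates \<open>G\<close> on \<open>A\<close>, \<open>R\<close> vanishes there and restores the leading coefficient;
    the claim is \<open>G = R + L\<close> at \<open>0\<close>.\<close>
  define G where "G = (\<Prod>v\<in>A. [:1, - v:])"
  define R where "R = smult (\<Prod>A) (\<Prod>v\<in>A. [:v, - 1:])"
  define B where "B u = (\<Prod>v\<in>A - {u}. [:v / (v - u), - 1 / (v - u):])" for u
  define L where "L = (\<Sum>u\<in>A. smult (poly G u) (B u))"
  have degB: "degree (B u) < card A" if "u \<in> A" for u
    unfolding B_def
    using le_less_trans[OF degree_prod_linear_polys_le[OF finite_Diff[OF A]] card_Diff1_less[OF A that]] .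
  have B_same: "poly (B u) u = 1" if "u \<in> A" for u
    unfolding B_def poly_prod by (rule prod.neutral) (auto simp: divide_simps)
  have B_other: "poly (B u) w = 0" if "u \<in> A" "w \<in> A" "u \<noteq> w" for u w
    unfolding B_def poly_prod using that A by (intro prod_zero) auto
  \<comment> \<open>Polynomials of degree at most \<open>card A\<close> coincide if they agree at
    the \<open>card A\<close> nodes and in the coefficient at \<open>card A\<close>. There
    \<open>L\<close> contributes 0, while \<open>G\<close> and \<open>R\<close> both have the
    product of all \<open>- v\<close>.\<close>
  have "G = R + L"
  proof (rule poly_eqI_degree_lead_coeff)
    have "coeff L (card A) = 0"
      unfolding L_def coeff_sum using degB by (intro sum.neutral) (simp add: coeff_eq_0)
    moreover have "coeff R (card A) = (\<Prod>v\<in>A. v * - 1)"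
      unfolding R_def prod.distrib by (simp add: coeff_prod_linear_polys_card[OF A])
    ultimately show "coeff G (card A) = coeff (R + L) (card A)"
      by (simp add: G_def coeff_prod_linear_polys_card[OF A])
    show "degree G \<le> card A"
      unfolding G_def by (rule degree_prod_linear_polys_le[OF A])
    have "degree R \<le> card A"
      unfolding R_def by (rule le_trans[OF degree_smult_le degree_prod_linear_polys_le[OF A]])
    moreover have "degree L \<le> card A"
      unfolding L_def using degB
      by (intro degree_sum_le[OF A] le_trans[OF degree_smult_le] less_imp_le)
    ultimately show "degree (R + L) \<le> card A"
      by (rule degree_add_le)
    show "poly G w = poly (R + L) w" if "w \<in> A" for w
    proof -
      have "poly R w = 0"
        unfolding R_def using that A by (auto simp: poly_prod)
      moreover have "poly L w = (\<Sum>u\<in>A. if u = w then poly G w else 0)"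
        unfolding L_def poly_sum using that
        by (intro sum.cong refl) (auto simp: B_same B_other)
      ultimately show ?thesis
        using that A by simp
    qed
  qed simp
  then have "poly G 0 = poly R 0 + poly L 0"
    by simp
  moreover have "poly G 0 = 1" "poly R 0 = (\<Prod>A)\<^sup>2"
    by (simp_all add: G_def R_def poly_prod power2_eq_square)
  moreover have "poly L 0 = (\<Sum>u\<in>A. (1 - u\<^sup>2) * (\<Prod>v\<in>A - {u}. v * (1 - u * v) / (v - u)))"
    unfolding L_def poly_sum
  proof (intro sum.cong refl)
    fix u assume u: "u \<in> A"
    have "poly G u = (1 - u\<^sup>2) * (\<Prod>v\<in>A - {u}. 1 - u * v)"
      using prod.remove[OF A u, of "\<lambda>v. 1 - u * v"] by (simp add: G_def poly_prod power2_eq_square)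
    moreover have "poly (B u) 0 = (\<Prod>v\<in>A - {u}. v / (v - u))"
      by (simp add: B_def poly_prod)
    ultimately show "poly (smult (poly G u) (B u)) 0 =
        (1 - u\<^sup>2) * (\<Prod>v\<in>A - {u}. v * (1 - u * v) / (v - u))"
      by (simp add: mult_ac flip: prod.distrib)
  qed
  ultimately show ?thesis
    by (simp add: algebra_simps)
qed

section \<open>Antisymmetric products over pairs\<close>

text \<open>For \<open>g u v = v - u\<close> this is the Vandermonde product.\<close>

definition pair_prod :: "('a \<Rightarrow> 'a \<Rightarrow> 'b :: comm_monoid_mult) \<Rightarrow> ('i :: linorder \<Rightarrow> 'a) \<Rightarrow> 'i set \<Rightarrow> 'b"
  where "pair_prod g x S = (\<Prod>j\<in>S. \<Prod>i | i \<in> S \<and> i < j. g (x i) (x j))"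

text \<open>The index \<open>a\<close> may lie anywhere in the order, so that any two indices can be
  split off when a transposition is applied.\<close>

lemma pair_prod_insert:
  assumes "finite S" "a \<notin> S"
  shows "pair_prod g x (insert a S) =
    (\<Prod>j\<in>S. if a < j then g (x a) (x j) else g (x j) (x a)) * pair_prod g x S"
proof -
  have 1: "(\<Prod>i | i \<in> insert a S \<and> i < j. g (x i) (x j)) =
      (if a < j then g (x a) (x j) else 1) * (\<Prod>i | i \<in> S \<and> i < j. g (x i) (x j))" for j
  proof (cases "a < j")
    case True
    then have "{i. i \<in> insert a S \<and> i < j} = insert a {i. i \<in> S \<and> i < j}"
      by auto
    then show ?thesis
      using True assms by simp
  next
    case False
    then have "{i. i \<in> insert a S \<and> i < j} = {i. i \<in> S \<and> i < j}"
      by auto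
    then show ?thesis
      using False by simp
  qed
  have 2: "(\<Prod>i | i \<in> S \<and> i < a. g (x i) (x a)) = (\<Prod>j\<in>S. if j < a then g (x j) (x a) else 1)"
    using prod.inter_filter[OF assms(1)] by simp
  have 3: "(if a < j then g (x a) (x j) else 1) * (if j < a then g (x j) (x a) else 1) =
      (if a < j then g (x a) (x j) else g (x j) (x a))" if "j \<in> S" for j
    using that assms(2) by (cases j a rule: linorder_cases) auto
  show ?thesis
    unfolding pair_prod_def 1 prod.insert[OF assms] prod.distrib
    by (simp add: 2 flip: mult.assoc prod.distrib) (simp add: 3 cong: prod.cong)
qed

text \<open>The pair formed by \<open>a\<close> and \<open>b\<close> changes sign. For any other
  \<open>j\<close>, the factors pairing it with \<open>a\<close> and with \<open>b\<close> are
  exchanged; if \<open>j\<close> lies between \<open>a\<close> and \<open>b\<close>, both also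
  change sign, and these signs cancel.\<close>

lemma pair_prod_transpose:
  fixes g :: "'a \<Rightarrow> 'a \<Rightarrow> 'b :: comm_ring_1"
  assumes S: "finite S" "a \<in> S" "b \<in> S" "a \<noteq> b" and g: "\<And>u v. g u v = - g v u"
  shows "pair_prod g (x \<circ> transpose a b) S = - pair_prod g x S"
proof -
  define T where "T = S - {a, b}"
  have T: "finite T" "a \<notin> T" "b \<notin> T" "S = insert a (insert b T)"
    using S by (auto simp: T_def)
  define d where "d y c j = (if c < j then g (y c) (y j) else g (y j) (y c))" for y :: "'c \<Rightarrow> 'a" and c j
  have split: "pair_prod g y S =
      d y a b * (\<Prod>j\<in>T. d y a j * d y b j) * pair_prod g y T" for y
    using T S(4) by (simp add: pair_prod_insert d_def prod.distrib mult.assoc)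
  let ?y = "x \<circ> transpose a b"
  have "pair_prod g ?y T = pair_prod g x T"
    unfolding pair_prod_def using T by (intro prod.cong refl) (auto simp: transpose_def)
  moreover have "d ?y a b = - d x a b"
    using g[of "x a" "x b"] by (simp add: d_def)
  moreover have "d ?y a j * d ?y b j = d x a j * d x b j" if "j \<in> T" for j
  proof -
    have "transpose a b j = j"
      using that T by (auto simp: transpose_def)
    then show ?thesis
      using g[of "x a" "x j"] g[of "x b" "x j"] by (simp add: d_def)
  qed
  ultimately show ?thesis
    by (simp add: split cong: prod.cong)
qed

section \<open>The alternating sum in an arbitrary field\<close>

text \<open>Turns a product over the positions other than \<open>a\<close> into one over the
  variables other than the one placed at \<open>a\<close>.\<close>

lemma prod_transpose_insert:
  assumes "finite S" "a \<notin> S" "b \<in> insert a S"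
  shows "(\<Prod>j\<in>S. f (transpose a b j)) = (\<Prod>j\<in>insert a S - {b}. f j)"
proof (rule prod.reindex_bij_witness[of _ "transpose a b" "transpose a b"])
qed (use assms in \<open>auto simp: transpose_def split: if_splits\<close>)

text \<open>The induction removes the position \<open>m\<close> and permutes \<open>x\<close>; both
  hypotheses survive this. They make all denominators nonzero: the differences of nodes by
  injectivity, the others by taking \<open>T\<close> to be a singleton, a pair or the whole
  interval.\<close>

lemma alternating_sum_prod_tails:
  fixes x :: "nat \<Rightarrow> 'a :: field"
  defines "g \<equiv> \<lambda>u v. (v - u) / (1 - u * v)" and "F \<equiv> \<lambda>z. z / (1 - z\<^sup>2)"
  assumes "inj_on x {m..n}" and "\<And>T. T \<subseteq> {m..n} \<Longrightarrow> T \<noteq> {} \<Longrightarrow> (\<Prod>j\<in>T. x j)\<^sup>2 \<noteq> 1"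
  shows "(\<Sum>w | w permutes {m..n}. of_int (sign w) * (\<Prod>k = m..n. F (\<Prod>j = k..n. x (w j)))) =
    (\<Prod>j = m..n. F (x j)) * pair_prod g x {m..n}"
  using assms(3,4)
proof (induction "Suc n - m" arbitrary: m x)
  case 0
  then have "{m..n} = {}"
    by simp
  then show ?case
    by (simp add: pair_prod_def)
next
  case (Suc d)
  define S' where "S' = {Suc m..n}"
  define S where "S = insert m S'"
  have mn: "m \<le> n" and S: "{m..n} = S"
    using Suc.hyps(2) by (auto simp: S_def S'_def)
  have fin: "finite S" "finite S'" "m \<notin> S'"
    by (auto simp: S_def S'_def)
  have x_inj: "inj_on x S" and x_ne: "\<And>T. T \<subseteq> S \<Longrightarrow> T \<noteq> {} \<Longrightarrow> (\<Prod>j\<in>T. x j)\<^sup>2 \<noteq> 1"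
    using Suc.prems by (simp_all add: S)
  define P where "P = (\<Prod>j\<in>S. x j)"
  define Q where "Q = (\<Prod>j\<in>S. 1 - (x j)\<^sup>2)"
  define c where "c i = (1 - (x i)\<^sup>2) * (\<Prod>j\<in>S - {i}. x j * (1 - x i * x j) / (x j - x i))" for i
  have P1: "1 - P\<^sup>2 \<noteq> 0"
    using x_ne[of S] by (auto simp: P_def S_def)
  have Q_ne: "1 - (x i)\<^sup>2 \<noteq> 0" if "i \<in> S" for i
    using x_ne[of "{i}"] that by auto
  have x_mult: "1 - x i * x j \<noteq> 0" if "i \<in> S" "j \<in> S" "i \<noteq> j" for i j
    using x_ne[of "{i, j}"] that by auto
  have g_anti: "g u v = - g v u" for u v
    by (simp add: g_def mult.commute minus_divide_left)
  have cancel: "y / q = inverse q * (y * a / b) * (b / a)" if "a \<noteq> 0" "b \<noteq> 0" for y q a b :: 'a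
    using that by (simp add: divide_simps)
  \<comment> \<open>Each permutation of \<open>S\<close> is uniquely
    \<open>transpose m i \<circ> q\<close> with \<open>q\<close> fixing \<open>m\<close>; then
    \<open>i\<close> is the image of \<open>m\<close>, so \<open>x i\<close> is the variable at
    position \<open>m\<close>.\<close>
  have inner: "(\<Sum>q | q permutes S'. of_int (sign (transpose m i \<circ> q)) *
      (\<Prod>k\<in>S. F (\<Prod>j = k..n. x ((transpose m i \<circ> q) j)))) = F P * pair_prod g x S / Q * c i"
    if i: "i \<in> S" for i
  proof -
    define t where "t = transpose m i"
    have t: "t permutes S"
      unfolding t_def using i by (intro permutes_swap_id) (auto simp: S_def)
    have tS': "t ` S' \<subseteq> S"
      using permutes_image[OF t] by (auto simp: S_def)
    have t_inj: "inj t"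
      using t by (rule permutes_inj)
    have IH: "(\<Sum>q | q permutes S'. of_int (sign q) * (\<Prod>k\<in>S'. F (\<Prod>j = k..n. (x \<circ> t) (q j)))) =
        (\<Prod>j\<in>S'. F ((x \<circ> t) j)) * pair_prod g (x \<circ> t) S'"
      unfolding S'_def
    proof (rule Suc.hyps(1))
      show "d = Suc n - Suc m"
        using Suc.hyps(2) by simp
      show "inj_on (x \<circ> t) {Suc m..n}"
        using t_inj tS' x_inj by (intro comp_inj_on) (auto intro: inj_on_subset simp: S'_def)
      fix T assume T: "T \<subseteq> {Suc m..n}" "T \<noteq> {}"
      then have "t ` T \<subseteq> S"
        using tS' by (auto simp: S'_def)
      then have "(\<Prod>j\<in>t ` T. x j)\<^sup>2 \<noteq> 1"
        using T by (intro x_ne) auto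
      then show "(\<Prod>j\<in>T. (x \<circ> t) j)\<^sup>2 \<noteq> 1"
        using t_inj by (simp add: prod.reindex inj_on_subset)
    qed
    \<comment> \<open>The tail starting at \<open>m\<close> runs over all of \<open>S\<close>, so
      its factor is \<open>F P\<close> for every permutation.\<close>
    have step: "of_int (sign (t \<circ> q)) * (\<Prod>k\<in>S. F (\<Prod>j = k..n. x ((t \<circ> q) j))) =
        F P * of_int (sign t) * (of_int (sign q) * (\<Prod>k\<in>S'. F (\<Prod>j = k..n. (x \<circ> t) (q j))) :: 'a)"
      if q: "q permutes S'" for q
    proof -
      have "q permutes S"
        using q by (rule permutes_subset) (auto simp: S_def)
      then have tq: "(t \<circ> q) permutes S"
        using t by (rule permutes_compose)
      have "(\<Prod>j = m..n. x ((t \<circ> q) j)) = P"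
        using prod.permute[OF tq, of x] by (simp add: S P_def)
      moreover have "sign (t \<circ> q) = sign t * sign q"
        using t q fin by (intro sign_compose) (auto simp: permutation_permutes)
      ultimately show ?thesis
        using fin unfolding S_def by (simp add: mult_ac)
    qed
    \<comment> \<open>For \<open>i = m\<close> the map \<open>t\<close> is the identity; otherwise
      its sign cancels the one from antisymmetry.\<close>
    have sgn: "of_int (sign t) * pair_prod g (x \<circ> t) S = pair_prod g x S"
    proof (cases "i = m")
      case True
      then show ?thesis
        by (simp add: t_def)
    next
      case False
      then show ?thesis
        using pair_prod_transpose[where x = x and a = m, OF fin(1) _ i _ g_anti]
        by (simp add: t_def sign_swap_id S_def)
    qed
    \<comment> \<open>As \<open>m\<close> is the least index and \<open>t\<close> sends it to
      \<open>i\<close>, the value \<open>x i\<close> comes first in every pair split off.\<close>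
    have "pair_prod g (x \<circ> t) S = (\<Prod>j\<in>S'. g (x i) (x (t j))) * pair_prod g (x \<circ> t) S'"
      unfolding S_def pair_prod_insert[OF fin(2,3)]
      by (intro arg_cong2[of _ _ _ _ "(*)"] prod.cong refl) (auto simp: t_def S'_def)
    also have "(\<Prod>j\<in>S'. g (x i) (x (t j))) = (\<Prod>j\<in>S - {i}. g (x i) (x j))"
      unfolding t_def S_def using fin i by (intro prod_transpose_insert) (auto simp: S_def)
    finally have split: "pair_prod g (x \<circ> t) S =
        (\<Prod>j\<in>S - {i}. g (x i) (x j)) * pair_prod g (x \<circ> t) S'" .
    have "Q = (1 - (x i)\<^sup>2) * (\<Prod>j\<in>S - {i}. 1 - (x j)\<^sup>2)"
      unfolding Q_def by (rule prod.remove[OF fin(1) i])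
    then have Q_split: "(\<Prod>j\<in>S - {i}. inverse (1 - (x j)\<^sup>2)) = (1 - (x i)\<^sup>2) / Q"
      using Q_ne[OF i] prod_inversef[of "\<lambda>j. 1 - (x j)\<^sup>2" "S - {i}"]
      by (simp add: comp_def divide_inverse)
    have "(\<Prod>j\<in>S'. F (x (t j))) = (\<Prod>j\<in>S - {i}. F (x j))"
      unfolding t_def S_def using fin i by (intro prod_transpose_insert) (auto simp: S_def)
    \<comment> \<open>Each \<open>F (x j)\<close> is multiplied by \<open>1 - x i * x j\<close> over
      \<open>x j - x i\<close> and by its inverse \<open>g (x i) (x j)\<close>: the former builds
      \<open>c i\<close>, the latter completes \<open>pair_prod\<close>.\<close>
    also have "\<dots> = (\<Prod>j\<in>S - {i}. inverse (1 - (x j)\<^sup>2) *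
        (x j * (1 - x i * x j) / (x j - x i)) * g (x i) (x j))"
    proof (rule prod.cong[OF refl])
      fix j assume j: "j \<in> S - {i}"
      then have "1 - x i * x j \<noteq> 0" "x j - x i \<noteq> 0"
        using i x_mult[of i j] inj_onD[OF x_inj, of j i] by auto
      then show "F (x j) = inverse (1 - (x j)\<^sup>2) * (x j * (1 - x i * x j) / (x j - x i)) * g (x i) (x j)"
        unfolding F_def g_def by (rule cancel)
    qed
    also have "\<dots> = c i / Q * (\<Prod>j\<in>S - {i}. g (x i) (x j))"
      unfolding prod.distrib Q_split c_def by (simp add: mult_ac)
    finally have F_eq: "(\<Prod>j\<in>S'. F (x (t j))) = c i / Q * (\<Prod>j\<in>S - {i}. g (x i) (x j))" .
    have "(\<Sum>q | q permutes S'. of_int (sign (t \<circ> q)) * (\<Prod>k\<in>S. F (\<Prod>j = k..n. x ((t \<circ> q) j)))) =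
        F P * of_int (sign t) * ((\<Prod>j\<in>S'. F ((x \<circ> t) j)) * pair_prod g (x \<circ> t) S')"
      unfolding IH[symmetric] sum_distrib_left by (intro sum.cong refl step) simp
    also have "\<dots> = F P * (c i / Q) * (of_int (sign t) * pair_prod g (x \<circ> t) S)"
      by (simp add: F_eq split mult_ac)
    finally show ?thesis
      unfolding sgn by (simp add: t_def mult_ac)
  qed
  have "(\<Sum>w | w permutes S. of_int (sign w) * (\<Prod>k\<in>S. F (\<Prod>j = k..n. x (w j)))) =
      (\<Sum>i\<in>S. F P * pair_prod g x S / Q * c i)"
    unfolding S_def sum_over_permutations_insert[OF fin(2,3)]
    by (rule sum.cong[OF refl], fold S_def, rule inner)
  also have "\<dots> = F P * pair_prod g x S / Q * (\<Sum>i\<in>S. c i)"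
    by (simp add: sum_distrib_left)
  also have "(\<Sum>i\<in>S. c i) = 1 - P\<^sup>2"
  proof -
    have "(\<Sum>i\<in>S. c i) = (\<Sum>u\<in>x ` S. (1 - u\<^sup>2) * (\<Prod>v\<in>x ` S - {u}. v * (1 - u * v) / (v - u)))"
      unfolding sum.reindex[OF x_inj] comp_def c_def
    proof (intro sum.cong refl arg_cong2[of _ _ _ _ "(*)"])
      fix i assume "i \<in> S"
      then have "x ` S - {x i} = x ` (S - {i})"
        using x_inj by (auto simp: inj_on_def)
      then show "(\<Prod>j\<in>S - {i}. x j * (1 - x i * x j) / (x j - x i)) =
          (\<Prod>v\<in>x ` S - {x i}. v * (1 - x i * v) / (v - x i))"
        using x_inj by (simp add: prod.reindex inj_on_diff)
    qed
    also have "\<dots> = 1 - P\<^sup>2"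
      using fin x_inj by (simp add: sum_lagrange_at_zero P_def prod.reindex)
    finally show ?thesis .
  qed
  \<comment> \<open>The Lagrange sum cancels exactly the denominator of \<open>F P\<close>.\<close>
  also have "F P * pair_prod g x S / Q * (1 - P\<^sup>2) = P / Q * pair_prod g x S"
    using P1 by (simp add: F_def)
  also have "P / Q = (\<Prod>j\<in>S. F (x j))"
    by (simp add: P_def Q_def F_def prod_dividef)
  finally show ?case
    by (simp add: S)
qed

section \<open>Formal exponentials and the Weyl group action\<close>

lemma fexp_sum: "fexp (sum f A) = (\<Prod>a\<in>A. fexp (f a))"
  by (induction A rule: infinite_finite_induct) (simp_all add: fexp_add)

lemma fexp_of_nat_scale: "fexp (of_nat k *\<^sub>w \<xi>) = fexp \<xi> ^ k"
proof (induction k)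
  case 0
  have "of_nat 0 *\<^sub>w \<xi> = 0"
    by (rule weight_eqI) simp
  then show ?case
    by simp
next
  case (Suc k)
  have "of_nat (Suc k) *\<^sub>w \<xi> = \<xi> + of_nat k *\<^sub>w \<xi>"
    by (rule weight_eqI) (simp add: algebra_simps)
  then show ?case
    by (simp only: fexp_add Suc.IH power_Suc)
qed

lemma fexp_eq_1_iff: "fexp \<xi> = 1 \<longleftrightarrow> \<xi> = 0"
  using fexp_inject[of \<xi> 0] by simp

lemma fexp_nonzero [simp]: "fexp \<xi> \<noteq> 0"
proof
  assume "fexp \<xi> = 0"
  then have "fexp (\<xi> + - \<xi>) = 0"
    by (simp only: fexp_add mult_zero_left)
  then show False
    by simp
qed

lemma fexp_uminus: "fexp (- \<xi>) = inverse (fexp \<xi>)"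
  using fexp_add[of \<xi> "- \<xi>"] by (simp add: inverse_unique)

lemma weyl_field_diff:
  assumes "inj w"
  shows "weyl_field w (a - b) = weyl_field w a - weyl_field w b"
  using weyl_field_add[OF assms, of "a - b" b] by simp

lemma weyl_field_divide:
  "inj w \<Longrightarrow> weyl_field w (a / b) = weyl_field w a / weyl_field w b"
  by (simp add: divide_inverse weyl_field_mult weyl_field_inverse)

lemma weyl_field_prod:
  "inj w \<Longrightarrow> weyl_field w (prod f A) = (\<Prod>a\<in>A. weyl_field w (f a))"
  by (induction A rule: infinite_finite_induct) (simp_all add: weyl_field_1 weyl_field_mult)

section \<open>Products over roots, and the exponentials of \<open>rho\<close> and
  \<open>beta\<close>\<close>

text \<open>Distinct pairs of indices give distinct roots, as the coordinates at \<open>i\<close>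
  and \<open>j\<close> show, so the product over the set of roots is a product over pairs.\<close>

lemma prod_pos_even_roots:
  "(\<Prod>\<alpha>\<in>pos_even_roots n. f \<alpha>) = (\<Prod>j = 1..n. \<Prod>i | i \<in> {1..n} \<and> i < j. f (eps i - eps j))"
proof -
  let ?I = "SIGMA j:{1..n}. {i. i \<in> {1..n} \<and> i < j}"
  let ?r = "\<lambda>(j, i). eps i - eps j"
  have "inj_on ?r ?I"
  proof (intro inj_onI, clarsimp)
    fix i j a b :: nat
    assume ij: "i < j" "a < b" and eq: "eps i - eps j = eps a - eps b"
    have "coord (eps i - eps j) k = coord (eps a - eps b) k" for k
      by (simp only: eq)
    from this[of i] this[of j] show "j = b \<and> i = a"
      using ij by (auto split: if_splits)
  qed
  moreover have "pos_even_roots n = ?r ` ?I"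
    unfolding pos_even_roots_def by (force simp: image_iff)
  ultimately show ?thesis
    by (simp only: prod.reindex) (simp add: prod.Sigma comp_def split_def)
qed

text \<open>The roots 2 \<epsilon>_j are kept apart because they supply the denominators of the
  \<open>F (x j)\<close>.\<close>

lemma prod_pos_odd_roots:
  "(\<Prod>\<alpha>\<in>pos_odd_roots n. f \<alpha>) =
    (\<Prod>j = 1..n. f (eps j + eps j) * (\<Prod>i | i \<in> {1..n} \<and> i < j. f (eps i + eps j)))"
proof -
  let ?I = "SIGMA j:{1..n}. {i. i \<in> {1..n} \<and> i \<le> j}"
  let ?r = "\<lambda>(j, i). eps i + eps j"
  have "inj_on ?r ?I"
  proof (intro inj_onI, clarsimp)
    fix i j a b :: nat
    assume ij: "i \<le> j" "a \<le> b" and eq: "eps i + eps j = eps a + eps b"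
    have "coord (eps i + eps j) k = coord (eps a + eps b) k" for k
      by (simp only: eq)
    from this[of i] this[of j] this[of a] this[of b] show "j = b \<and> i = a"
      using ij by (auto split: if_splits)
  qed
  moreover have "pos_odd_roots n = ?r ` ?I"
    unfolding pos_odd_roots_eq by (force simp: image_iff)
  ultimately have "(\<Prod>\<alpha>\<in>pos_odd_roots n. f \<alpha>) =
      (\<Prod>j = 1..n. \<Prod>i | i \<in> {1..n} \<and> i \<le> j. f (eps i + eps j))"
    by (simp only: prod.reindex) (simp add: prod.Sigma comp_def split_def)
  moreover have "{i. i \<in> {1..n} \<and> i \<le> j} = insert j {i. i \<in> {1..n} \<and> i < j}" if "j \<in> {1..n}" for j
    using that by auto
  ultimately show ?thesis
    by simp
qed

text \<open>The factor \<open>x j\<close> occurs in the tails starting at 1, ..., \<open>j\<close>.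
  This spreads the exponential of \<open>rho\<close> over the numerators of the \<open>F\<close>
  factors, one tail each.\<close>

lemma prod_prod_tails:
  fixes x :: "nat \<Rightarrow> 'a :: comm_monoid_mult"
  shows "(\<Prod>k = 1..n. \<Prod>j = k..n. x j) = (\<Prod>j = 1..n. x j ^ j)"
proof -
  have "(\<Prod>k = 1..n. \<Prod>j = k..n. x j) = (\<Prod>k = 1..n. \<Prod>j | j \<in> {1..n} \<and> k \<le> j. x j)"
    by (intro prod.cong refl) auto
  also have "\<dots> = (\<Prod>j = 1..n. \<Prod>k | k \<in> {1..n} \<and> k \<le> j. x j)"
    by (rule prod.swap_restrict) auto
  also have "\<dots> = (\<Prod>j = 1..n. x j ^ j)"
  proof (intro prod.cong refl)
    fix j assume "j \<in> {1..n}"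
    then have "{k. k \<in> {1..n} \<and> k \<le> j} = {1..j}"
      by auto
    then show "(\<Prod>k | k \<in> {1..n} \<and> k \<le> j. x j) = x j ^ j"
      by simp
  qed
  finally show ?thesis .
qed

lemma fexp_rho: "fexp (rho n) = (\<Prod>j = 1..n. fexp (- eps j) ^ j)"
proof -
  have "- (of_nat i *\<^sub>w eps i) = of_nat i *\<^sub>w (- eps i)" for i
    by (rule weight_eqI) simp
  then show ?thesis
    by (simp add: rho_def fexp_sum fexp_of_nat_scale flip: sum_negf)
qed

lemma fexp_sum_beta:
  assumes "k \<le> n"
  shows "fexp (- (\<Sum>j = 1..k. beta n j)) = (\<Prod>j = n + 1 - k..n. fexp (- eps j))\<^sup>2"
proof -
  have "(\<Sum>j = 1..k. beta n j) = (\<Sum>j = n + 1 - k..n. 2 *\<^sub>w eps j)"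
    by (rule sum.reindex_bij_witness[of _ "\<lambda>j. n + 1 - j" "\<lambda>j. n + 1 - j"])
      (use assms in \<open>auto simp: beta_def\<close>)
  moreover have "- (2 *\<^sub>w eps j) = - eps j + - eps j" for j
    by (rule weight_eqI) simp
  ultimately show ?thesis
    by (simp only: sum_negf[symmetric] fexp_sum fexp_add prod.distrib power2_eq_square)
qed

section \<open>Specialisation to formal exponentials\<close>

theorem theorem4p1:
  fixes n :: nat
  assumes "n \<ge> 1"
  shows "fexp (rho n) * super_denominator n =
    (\<Sum>w | w permutes {1..n}. of_int (sign w) *
       weyl_field w (fexp (rho n) / (\<Prod>k = 1..n. 1 - fexp (- (\<Sum>j = 1..k. beta n j)))))"
proof -
  define x where "x i = fexp (- eps i)" for i
  define g :: "exp_field \<Rightarrow> exp_field \<Rightarrow> exp_field" where "g = (\<lambda>u v. (v - u) / (1 - u * v))"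
  define F :: "exp_field \<Rightarrow> exp_field" where "F = (\<lambda>z. z / (1 - z\<^sup>2))"
  have "eps i = eps j \<longleftrightarrow> i = j" for i j
    by (metis coord_simps(6) one_neq_zero)
  then have x_inj: "inj_on x {1..n}"
    by (auto simp: inj_on_def x_def fexp_inject)
  have x_ne: "(\<Prod>j\<in>T. x j)\<^sup>2 \<noteq> 1" if T: "T \<subseteq> {1..n}" "T \<noteq> {}" for T
  proof -
    obtain t where "t \<in> T" "finite T"
      using T finite_subset by blast
    \<comment> \<open>The coordinate is -2, coming from the summand with index \<open>t\<close>
      alone.\<close>
    then have "coord (\<Sum>j\<in>T. - eps j + - eps j) t \<noteq> 0"
      by (simp add: coord_sum sum.distrib sum_negf if_distrib cong: if_cong)
    then have "(\<Sum>j\<in>T. - eps j + - eps j) \<noteq> 0"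
      by auto
    then show ?thesis
      using fexp_eq_1_iff[of "\<Sum>j\<in>T. - eps j + - eps j"]
      by (simp only: x_def fexp_sum fexp_add prod.distrib power2_eq_square not_False_eq_True)
  qed
  have rho_tails: "fexp (rho n) = (\<Prod>k = 1..n. \<Prod>j = k..n. x j)"
    unfolding fexp_rho prod_prod_tails x_def ..
  have "(\<Prod>k = 1..n. 1 - fexp (- (\<Sum>j = 1..k. beta n j))) = (\<Prod>k = 1..n. 1 - (\<Prod>j = n + 1 - k..n. x j)\<^sup>2)"
    unfolding x_def
    by (intro prod.cong refl arg_cong2[of _ _ _ _ "(-)"] fexp_sum_beta) simp
  \<comment> \<open>The \<open>beta\<close> are numbered from \<epsilon>_n downwards, so reversing
    \<open>k\<close> matches each denominator with the tail starting at \<open>k\<close>.\<close>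
  also have "\<dots> = (\<Prod>k = 1..n. 1 - (\<Prod>j = k..n. x j)\<^sup>2)"
    by (rule prod.reindex_bij_witness[of _ "\<lambda>k. n + 1 - k" "\<lambda>k. n + 1 - k"]) auto
  finally have tails: "fexp (rho n) / (\<Prod>k = 1..n. 1 - fexp (- (\<Sum>j = 1..k. beta n j))) =
      (\<Prod>k = 1..n. F (\<Prod>j = k..n. x j))"
    by (simp add: rho_tails F_def prod_dividef)
  have "weyl_field w (\<Prod>k = 1..n. F (\<Prod>j = k..n. x j)) = (\<Prod>k = 1..n. F (\<Prod>j = k..n. x (w j)))"
    if "w permutes {1..n}" for w
    using permutes_inj[OF that]
    by (simp add: F_def x_def power2_eq_square weyl_field_prod weyl_field_divide weyl_field_diff
        weyl_field_1 weyl_field_mult weyl_field_fexp weyl_weight_uminus)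
  then have "(\<Sum>w | w permutes {1..n}. of_int (sign w) *
       weyl_field w (fexp (rho n) / (\<Prod>k = 1..n. 1 - fexp (- (\<Sum>j = 1..k. beta n j))))) =
      (\<Sum>w | w permutes {1..n}. of_int (sign w) * (\<Prod>k = 1..n. F (\<Prod>j = k..n. x (w j))))"
    unfolding tails by (intro sum.cong refl) simp
  also have "\<dots> = (\<Prod>j = 1..n. F (x j)) * pair_prod g x {1..n}"
    unfolding F_def g_def by (rule alternating_sum_prod_tails[OF x_inj x_ne])
  also have "\<dots> = fexp (rho n) * super_denominator n"
  proof -
    \<comment> \<open>One of the \<open>j\<close> copies of \<open>x j\<close> becomes the numerator
      of \<open>F (x j)\<close>; the other \<open>j - 1\<close> clear the denominators of the even
      factors, each being 1 minus \<open>x i / x j\<close>.\<close>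
    have "x j ^ j * (\<Prod>i | i \<in> {1..n} \<and> i < j. 1 - fexp (- (eps i - eps j))) =
        x j * (\<Prod>i | i \<in> {1..n} \<and> i < j. x j - x i)" if j: "j \<in> {1..n}" for j
    proof -
      have "{i. i \<in> {1..n} \<and> i < j} = {1..<j}"
        using j by auto
      moreover have "x j * (1 - fexp (- (eps i - eps j))) = x j - x i" for i
      proof -
        have "fexp (- (eps i - eps j)) = fexp (- eps i) * fexp (eps j)"
          by (simp flip: fexp_add)
        then show ?thesis
          by (simp add: x_def fexp_uminus algebra_simps)
      qed
      moreover have "x j ^ j = x j * (\<Prod>i = 1..<j. x j)"
        using j by (simp flip: power_Suc)
      ultimately show ?thesis
        by (simp only: mult.assoc prod.distrib[symmetric])
    qed
    then have "fexp (rho n) * (\<Prod>\<alpha>\<in>pos_even_roots n. 1 - fexp (- \<alpha>)) =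
        (\<Prod>j = 1..n. x j * (\<Prod>i | i \<in> {1..n} \<and> i < j. x j - x i))"
      unfolding prod_pos_even_roots fexp_rho x_def[symmetric] prod.distrib[symmetric]
      by (rule prod.cong[OF refl])
    moreover have "fexp (- (eps i + eps j)) = x i * x j" for i j
      by (simp add: x_def flip: fexp_add)
    then have "(\<Prod>\<alpha>\<in>pos_odd_roots n. 1 - fexp (- \<alpha>)) =
        (\<Prod>j = 1..n. (1 - (x j)\<^sup>2) * (\<Prod>i | i \<in> {1..n} \<and> i < j. 1 - x i * x j))"
      by (simp only: prod_pos_odd_roots power2_eq_square)
    ultimately show ?thesis
      unfolding super_denominator_def times_divide_eq_right
      by (simp only: pair_prod_def F_def g_def prod_dividef prod.distrib times_divide_times_eq)
  qed
  finally show ?thesis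
    by (rule sym)
qed

end
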